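(* Let $\mathcal{X}\subset\mathbb{R}^d$ be closed and convex, and let $f,g$ be continuous on $\mathcal{X}$ with $\partial f(x)\neq\emptyset$, $\partial g(x)\neq\emptyset$ for all $x\in\mathcal{X}$. Suppose there is $M>0$ with $\|\zeta_f\|\le M$, $\|\zeta_g\|\le M$ for all $x\in\mathcal{X}$, $\zeta_f\in\partial f(x)$, $\zeta_g\in\partial g(x)$. Suppose further: (A) $f$ and $g$ are $\rho$-weakly convex on $\mathcal{X}$; (B) there are $\bar\epsilon>0$, $\theta>0$, $\bar\rho>\rho$ such that for every $x\in\mathcal{X}$ with $g(x)\le\bar\epsilon^2$ there is $y\in\mathrm{relint}(\mathcal{X})$ with $g(y)+\frac{\bar\rho}{2}\|y-x\|^2\le-\theta$; (C) $\underline f:=\inf_{x\in\mathcal{X}}f(x)>-\infty$. Let $\mathcal{S}=\{x\in\mathcal{X}: g(x)\le0\}$. Let $\hat\rho$ satisfy $\bar\rho\ge\hat\rho>\rho$, let $0<\epsilon\le\bar\epsilon$, and put $\nu:=\sqrt{2\theta(\hat\rho-\rho)}$, $\Lambda':=2M/\sqrt{2\theta(\hat\rho-\rho)}$, $C:=2\sqrt{\frac{1+\Lambda'}{\hat\rho-\rho}}$. Run the switching subgradient method (described in the context) with $x^{(0)}\in\mathcal{S}$, $S=0$, $\epsilon_t=\frac{\nu}{4}\min\{\epsilon^2/M,\nu/(4\rho)\}$, $$\eta_t=\begin{cases}\frac{\nu}{4M^2}\min\{\epsilon^2/M,\nu/(4\rho)\}&\text{if }t\in I,\\ g(x^{(t)})/\|\zeta_g^{(t)}\|^2&\text{if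 }t\in J,\end{cases}$$ and $$T\ge\frac{8M^2\big(f(x^{(0)})-\underline f+3M^2/(2\hat\rho)\big)}{\hat\rho(1+\Lambda')\,\nu\,\epsilon^2\min\{\epsilon^2/M,\nu/(4\rho)\}}$$ (a bound of order $O(1/\epsilon^4)$), and let $x^{(\tau)}$ be generated by Output II. Then $$\mathbb{E}_\tau\big[\|\widehat{x}^{(\tau)}-x^{(\tau)}\|\big]\le C\epsilon\quad\text{and}\quad\mathbb{E}_\tau\big[g(x^{(\tau)})\big]\le\epsilon^2,$$ where $\widehat{x}^{(t)}:=\arg\min_{y\in\mathcal{X}}\big\{f(y)+\frac{\hat\rho}{2}\|y-x^{(t)}\|^2:\ g(y)+\frac{\hat\rho}{2}\|y-x^{(t)}\|^2\le0\big\}$.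
   Context: $\|\cdot\|$ is the Euclidean norm. For $h:\mathbb{R}^d\to\mathbb{R}\cup\{+\infty\}$, $\partial h(x)=\{\zeta\in\mathbb{R}^d: h(x')\ge h(x)+\langle\zeta,x'-x\rangle+o(\|x'-x\|),\ x'\to x\}$. $h$ is $\rho$-weakly convex on $\mathcal{X}$ ($\rho\ge0$) if $h(x)\ge h(x')+\langle\zeta,x-x'\rangle-\frac{\rho}{2}\|x-x'\|^2$ for all $x,x'\in\mathcal{X}$ and $\zeta\in\partial h(x')$. The problem under study is $\min_{x\in\mathcal{X}}f(x)$ subject to $g(x)\le0$. $\mathrm{proj}_{\mathcal X}$ is Euclidean projection onto $\mathcal{X}$; relint is relative interior. If $\rho=0$, $\nu/(4\rho)$ is read as $+\infty$. Switching subgradient method. Input: $x^{(0)}\in\mathcal{X}$, number of iterations $T$ (a positive integer), tolerances $\epsilon_t\ge0$, stepsizes $\eta_t$, and an integer starting index $S$. Initialize $I=J=\emptyset$. For $t=0,1,\dots,T-1$: if $g(x^{(t)})\le\epsilon_t$, set $x^{(t+1)}=\mathrm{proj}_{\mathcal X}(x^{(t)}-\eta_t\zeta_f^{(t)})$ for any $\zeta_f^{(t)}\in\partial f(x^{(t)})$ and, if $t\ge S$, add $t$ to $I$; otherwise set $x^{(t+1)}=\mathrm{proj}_{\mathcal X}(x^{(t)}-\eta_t\zeta_g^{(t)})$ for any $\zeta_g^{(t)}\in\partial g(x^{(t)})$ and, if $t\ge S$, add $t$ to $J$. Output II: $x^{(\tau)}$ with $\tau$ randomly sampled from $I\cup J$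 with $\mathrm{Prob}(\tau=t)=\eta_t/\sum_{s\in I\cup J}\eta_s$. $\mathbb{E}_\tau$ is the expectation over the random index $\tau$ only.
   Formalization: If g<0 on all of X, the formal theorem additionally assumes ν ≤ M; otherwise ν ≤ M follows from the hypotheses. Without it the claim fails, e.g. X=ℝ, f=|x|, g=−θ=−320000, ρ=0, ρ̄=ρ̂=M=1, ε=ε̄=1/10, x⁽⁰⁾=1. *)

theory Defs
  imports
    "HOL-Analysis.Analysis"
    "HOL-Probability.Probability"
    "HOL-Library.Landau_Symbols"
begin

text \<open>
  Functions with values in the reals extended by plus infinity are modelled as \<open>ereal\<close>-valued
  functions; exclusion of minus infinity is a separate hypothesis.
\<close>

definition subdifferential :: "('a::euclidean_space \<Rightarrow> ereal) \<Rightarrow> 'a \<Rightarrow> 'a set" where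
  "subdifferential h x =
     {\<zeta>. \<exists>r :: 'a \<Rightarrow> real. r \<in> o[at x](\<lambda>x'. norm (x' - x)) \<and>
        (\<forall>\<^sub>F x' in at x. h x' \<ge> h x + ereal (\<zeta> \<bullet> (x' - x) + r x'))}"

definition weakly_convex_on :: "real \<Rightarrow> 'a::euclidean_space set \<Rightarrow> ('a \<Rightarrow> ereal) \<Rightarrow> bool" where
  "weakly_convex_on \<rho> X h \<longleftrightarrow> 0 \<le> \<rho> \<and>
     (\<forall>x\<in>X. \<forall>x'\<in>X. \<forall>\<zeta>\<in>subdifferential h x'.
        h x \<ge> h x' + ereal (\<zeta> \<bullet> (x - x') - \<rho> / 2 * (norm (x - x'))\<^sup>2))"

text \<open>
  The iterates \<open>x\<close> and the chosen subgradients \<open>\<zeta>f\<close>, \<open>\<zeta>g\<close> are arbitrary sequences related by the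
  update rule, so every admissible choice of subgradients is covered. The stepsizes \<open>\<eta>\<close> may depend
  on the run.
\<close>

definition switching_subgradient_run ::
  "'a::euclidean_space set \<Rightarrow> ('a \<Rightarrow> ereal) \<Rightarrow> ('a \<Rightarrow> ereal) \<Rightarrow> nat \<Rightarrow> (nat \<Rightarrow> real) \<Rightarrow> (nat \<Rightarrow> real) \<Rightarrow>
   (nat \<Rightarrow> 'a) \<Rightarrow> (nat \<Rightarrow> 'a) \<Rightarrow> (nat \<Rightarrow> 'a) \<Rightarrow> bool" where
  "switching_subgradient_run X f g T tol \<eta> x \<zeta>f \<zeta>g \<longleftrightarrow>
     0 < T \<and> (\<forall>t<T. 0 \<le> tol t) \<and> x 0 \<in> X \<and>
     (\<forall>t<T. if g (x t) \<le> ereal (tol t)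
        then \<zeta>f t \<in> subdifferential f (x t) \<and>
             x (Suc t) = closest_point X (x t - \<eta> t *\<^sub>R \<zeta>f t)
        else \<zeta>g t \<in> subdifferential g (x t) \<and>
             x (Suc t) = closest_point X (x t - \<eta> t *\<^sub>R \<zeta>g t))"

definition index_set_I ::
  "('a \<Rightarrow> ereal) \<Rightarrow> nat \<Rightarrow> int \<Rightarrow> (nat \<Rightarrow> real) \<Rightarrow> (nat \<Rightarrow> 'a) \<Rightarrow> nat set" where
  "index_set_I g T S tol x = {t. t < T \<and> S \<le> int t \<and> g (x t) \<le> ereal (tol t)}"

definition index_set_J ::
  "('a \<Rightarrow> ereal) \<Rightarrow> nat \<Rightarrow> int \<Rightarrow> (nat \<Rightarrow> real) \<Rightarrow> (nat \<Rightarrow> 'a) \<Rightarrow> nat set" where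
  "index_set_J g T S tol x = {t. t < T \<and> S \<le> int t \<and> \<not> g (x t) \<le> ereal (tol t)}"

text \<open>
  The law of the random index of Output II, where \<open>A\<close> is the union of the two index sets.
  \<open>embed_pmf\<close> is meaningful only for nonnegative weights that sum to one.
\<close>

definition output_II :: "nat set \<Rightarrow> (nat \<Rightarrow> real) \<Rightarrow> nat pmf" where
  "output_II A \<eta> = embed_pmf (\<lambda>t. if t \<in> A then \<eta> t / (\<Sum>s\<in>A. \<eta> s) else 0)"

definition proximal_point ::
  "'a::euclidean_space set \<Rightarrow> ('a \<Rightarrow> ereal) \<Rightarrow> ('a \<Rightarrow> ereal) \<Rightarrow> real \<Rightarrow> 'a \<Rightarrow> 'a" where
  "proximal_point X f g \<rho>' x =
     arg_min_on (\<lambda>y. f y + ereal (\<rho>' / 2 * (norm (y - x))\<^sup>2))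
       {y \<in> X. g y + ereal (\<rho>' / 2 * (norm (y - x))\<^sup>2) \<le> 0}"

text \<open>The minimum of \<open>a\<close> and \<open>\<nu> / (4 * \<rho>)\<close>, the latter read as plus infinity if \<open>\<rho> = 0\<close>.\<close>

definition capped_min :: "real \<Rightarrow> real \<Rightarrow> real \<Rightarrow> real" where
  "capped_min a \<nu> \<rho> = (if \<rho> = 0 then a else min a (\<nu> / (4 * \<rho>)))"

text \<open>
  Pitfall: if \<open>g < 0\<close> on all of \<open>X\<close>, nothing ties \<open>\<theta>\<close> to the subgradient bound \<open>M\<close>, and the rate
  fails when \<open>\<nu>\<close> is much larger than \<open>M\<close>. Example on the real line: \<open>f x = \<bar>x\<bar>\<close>, \<open>g x = -320000\<close>,
  \<open>\<theta> = 320000\<close>, \<open>\<rho> = 0\<close>, \<open>\<rho>_bar = \<rho>_hat = M = 1\<close>, \<open>eps = eps_bar = 1/10\<close>; then \<open>\<nu> = 800\<close>, all steps are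
  2, the iterates alternate between 1 and -1, and their proximal point is 0. The theorem therefore
  assumes \<open>\<nu> \<le> M\<close> in that case only; if \<open>g y \<ge> 0\<close> for some \<open>y\<close> in \<open>X\<close>, \<open>\<nu> \<le> M\<close> is a consequence of
  the other hypotheses.
\<close>

end

theory Submission
  imports Defs
begin

text \<open>
  Slater's condition gives, at every \<open>z\<close> in \<open>X\<close> with \<open>g z \<le> eps_bar\<^sup>2\<close>, the error bound
  \<open>dist(z, S) \<le> g z / \<nu>\<close> and a Lagrange multiplier in \<open>[0, \<Lambda>]\<close> for the strongly convex proximal
  problem centred at \<open>z\<close>. By the error bound a Polyak step on \<open>g\<close> does not increase the distance to a
  nearby feasible point, and a short step on \<open>f\<close> starts within \<open>m / 4\<close> of \<open>S\<close>; hence every iterate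
  stays within \<open>m\<close> of \<open>S\<close>, so that \<open>g \<le> M * m \<le> eps\<^sup>2\<close> there. The optimal value of the proximal
  problem at the current iterate serves as potential: by weak duality at the new iterate it changes by
  at most \<open>\<rho>_hat / 2 * \<eta> t * ((1 + \<Lambda>) * (1 + 2 * \<Lambda>) * tol - (\<rho>_hat - \<rho>) * d\<^sup>2)\<close>, where \<open>d\<close> is the
  distance from \<open>x t\<close> to its proximal point. Telescoping bounds the mean of \<open>d\<^sup>2\<close>, hence that of \<open>d\<close>.
\<close>

section \<open>Weak convexity along segments\<close>

text \<open>The subgradient-free form: \<open>h\<close> plus \<open>\<rho> / 2\<close> times the
  squared norm is convex along the segments of \<open>X\<close>. Negative moduli are allowed and
  express strong convexity, so one notion serves \<open>F\<close>, \<open>G\<close> and the proximal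
  functions.\<close>

definition segment_weakly_convex :: "real \<Rightarrow> 'a::euclidean_space set \<Rightarrow> ('a \<Rightarrow> real) \<Rightarrow> bool" where
  "segment_weakly_convex \<rho> X h \<longleftrightarrow> (\<forall>a\<in>X. \<forall>b\<in>X. \<forall>s\<in>{0..1}.
     h ((1 - s) *\<^sub>R a + s *\<^sub>R b)
       \<le> (1 - s) * h a + s * h b + \<rho> / 2 * s * (1 - s) * (norm (a - b))\<^sup>2)"

lemma segment_weakly_convexD:
  assumes "segment_weakly_convex \<rho> X h" "a \<in> X" "b \<in> X" "0 \<le> s" "s \<le> 1"
  shows "h ((1 - s) *\<^sub>R a + s *\<^sub>R b)
    \<le> (1 - s) * h a + s * h b + \<rho> / 2 * s * (1 - s) * (norm (a - b))\<^sup>2"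
  using assms unfolding segment_weakly_convex_def by auto

lemma convex_segment_mem:
  assumes "convex X" "a \<in> X" "b \<in> X" "0 \<le> s" "s \<le> (1::real)"
  shows "(1 - s) *\<^sub>R a + s *\<^sub>R b \<in> X"
  using convexD[OF assms(1-3), of "1 - s" s] assms by simp

text \<open>Averaging the subgradient inequalities at the point \<open>y\<close> of the segment,
  tested at both endpoints, cancels the linear terms; the quadratic ones combine since (1 - s) s^2 +
  s (1 - s)^2 = s (1 - s).\<close>

lemma segment_weakly_convex_subgradient:
  assumes "convex X"
    and sub: "\<And>y. y \<in> X \<Longrightarrow> \<exists>\<zeta>. \<forall>w\<in>X. h w \<ge> h y + \<zeta> \<bullet> (w - y) - \<rho> / 2 * (norm (w - y))\<^sup>2"
  shows "segment_weakly_convex \<rho> X h"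
  unfolding segment_weakly_convex_def
proof (intro ballI)
  fix a b :: 'a and s :: real
  assume ab: "a \<in> X" "b \<in> X" and s: "s \<in> {0..1}"
  define y where "y = (1 - s) *\<^sub>R a + s *\<^sub>R b"
  have y: "y \<in> X" using convex_segment_mem[OF assms(1) ab] s unfolding y_def by auto
  obtain \<zeta> where \<zeta>: "\<forall>w\<in>X. h w \<ge> h y + \<zeta> \<bullet> (w - y) - \<rho> / 2 * (norm (w - y))\<^sup>2"
    using sub[OF y] by blast
  define D where "D = (norm (a - b))\<^sup>2"
  define k where "k = \<zeta> \<bullet> (a - b)"
  have ya: "a - y = s *\<^sub>R (a - b)" and yb: "b - y = (s - 1) *\<^sub>R (a - b)"
    unfolding y_def by (simp_all add: algebra_simps)
  have "h a \<ge> h y + s * k - \<rho> / 2 * (s\<^sup>2 * D)"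
    using \<zeta>[rule_format, OF ab(1)] unfolding ya k_def D_def by (simp add: power_mult_distrib)
  hence 1: "(1 - s) * h a \<ge> (1 - s) * (h y + s * k - \<rho> / 2 * (s\<^sup>2 * D))"
    using s by (intro mult_left_mono) auto
  have "h b \<ge> h y + (s - 1) * k - \<rho> / 2 * ((s - 1)\<^sup>2 * D)"
    using \<zeta>[rule_format, OF ab(2)] unfolding yb k_def D_def
    by (simp add: power_mult_distrib)
  hence 2: "s * h b \<ge> s * (h y + (s - 1) * k - \<rho> / 2 * ((s - 1)\<^sup>2 * D))"
    using s by (intro mult_left_mono) auto
  have "(1 - s) * (h y + s * k - \<rho> / 2 * (s\<^sup>2 * D)) + s * (h y + (s - 1) * k - \<rho> / 2 * ((s - 1)\<^sup>2 * D))
      = h y - \<rho> / 2 * s * (1 - s) * D"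
    by (simp add: power2_eq_square field_simps)
  thus "h ((1 - s) *\<^sub>R a + s *\<^sub>R b)
      \<le> (1 - s) * h a + s * h b + \<rho> / 2 * s * (1 - s) * (norm (a - b))\<^sup>2"
    using 1 2 unfolding y_def[symmetric] D_def[symmetric] by linarith
qed

text \<open>One subgradient inequality gives the Lipschitz bound up to a quadratic error. Cutting
  the segment into \<open>n + 1\<close> equal pieces divides the total error by
  \<open>n + 1\<close>, and \<open>n\<close> tends to infinity.\<close>

lemma lipschitz_of_subgradients:
  fixes X :: "'a::euclidean_space set"
  assumes "convex X"
    and sub: "\<And>y. y \<in> X \<Longrightarrow>
      \<exists>\<zeta>. norm \<zeta> \<le> M \<and> (\<forall>w\<in>X. h w \<ge> h y + \<zeta> \<bullet> (w - y) - \<rho> / 2 * (norm (w - y))\<^sup>2)"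
    and ab: "a \<in> X" "b \<in> X"
  shows "h b - h a \<le> M * norm (b - a)"
proof -
  define D where "D = norm (b - a)"
  have local: "h v - h u \<le> M * norm (v - u) + \<rho> / 2 * (norm (v - u))\<^sup>2"
    if uv: "u \<in> X" "v \<in> X" for u v
  proof -
    obtain \<zeta> where \<zeta>: "norm \<zeta> \<le> M" "h u \<ge> h v + \<zeta> \<bullet> (u - v) - \<rho> / 2 * (norm (u - v))\<^sup>2"
      using sub[OF uv(2)] uv(1) by blast
    have "\<bar>\<zeta> \<bullet> (u - v)\<bar> \<le> M * norm (u - v)"
      using Cauchy_Schwarz_ineq2[of \<zeta> "u - v"] mult_right_mono[OF \<zeta>(1), of "norm (u - v)"] by simp
    with \<zeta>(2) show ?thesis by (simp add: norm_minus_commute)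
  qed
  have step: "h b - h a \<le> M * D + (\<rho> / 2 * D\<^sup>2) * inverse (real (Suc n))" for n
  proof -
    define N where "N = real (Suc n)"
    define p where "p i = (1 - real i / N) *\<^sub>R a + (real i / N) *\<^sub>R b" for i :: nat
    have p: "p i \<in> X" if "i \<le> Suc n" for i
      unfolding p_def by (rule convex_segment_mem[OF assms(1) ab]) (use that in \<open>auto simp: N_def\<close>)
    have "h b - h a = (\<Sum>i<Suc n. h (p (Suc i)) - h (p i))"
      using sum_lessThan_telescope[of "\<lambda>i. h (p i)" "Suc n"] by (simp add: p_def N_def)
    also have "\<dots> \<le> (\<Sum>i<Suc n. M * (D / N) + \<rho> / 2 * (D / N)\<^sup>2)"
    proof (rule sum_mono)
      fix i assume "i \<in> {..<Suc n}"
      have "p (Suc i) - p i = (1 / N) *\<^sub>R (b - a)"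
        unfolding p_def by (simp add: algebra_simps add_divide_distrib)
      hence "norm (p (Suc i) - p i) = D / N" by (simp add: D_def N_def)
      thus "h (p (Suc i)) - h (p i) \<le> M * (D / N) + \<rho> / 2 * (D / N)\<^sup>2"
        using local[of "p i" "p (Suc i)"] p \<open>i \<in> _\<close> by auto
    qed
    also have "\<dots> = N * (M * (D / N) + \<rho> / 2 * (D / N)\<^sup>2)" by (simp add: N_def)
    also have "\<dots> = M * D + (\<rho> / 2 * D\<^sup>2) * inverse N"
      by (simp add: N_def field_simps power2_eq_square del: of_nat_Suc)
    finally show ?thesis by (simp add: N_def)
  qed
  have "(\<lambda>n. M * D + (\<rho> / 2 * D\<^sup>2) * inverse (real (Suc n))) \<longlonglongrightarrow> M * D + (\<rho> / 2 * D\<^sup>2) * 0"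
    by (intro tendsto_intros LIMSEQ_inverse_real_of_nat)
  from LIMSEQ_le_const[OF this] step show ?thesis unfolding D_def by auto
qed

text \<open>Replaces directional derivatives: the effect of a perturbation of size \<open>s\<close>
  is divided by \<open>s\<close>, and the remainder \<open>s * K\<close> vanishes as
  \<open>s\<close> tends to 0.\<close>

lemma le_if_le_add_vanishing:
  fixes A B K :: real
  assumes "\<And>s. 0 < s \<Longrightarrow> s < 1 \<Longrightarrow> A \<le> B + s * K"
  shows "A \<le> B"
proof -
  have "((\<lambda>s. B + s * K) \<longlongrightarrow> B + 0 * K) (at_right 0)" by (intro tendsto_intros)
  moreover have "eventually (\<lambda>s. A \<le> B + s * K) (at_right 0)"
    unfolding eventually_at_right_field using assms by (intro exI[of _ 1]) auto
  ultimately show ?thesis using tendsto_lowerbound[of _ "B + 0 * K"] by fastforce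
qed

section \<open>Strong convexity, quadratic growth and Lagrange multipliers\<close>

lemma norm_convex_combination_sq:
  fixes a b :: "'a::real_inner"
  shows "(norm ((1 - s) *\<^sub>R a + s *\<^sub>R b))\<^sup>2
    = (1 - s) * (norm a)\<^sup>2 + s * (norm b)\<^sup>2 - s * (1 - s) * (norm (a - b))\<^sup>2"
  unfolding power2_norm_eq_inner
  by (simp add: inner_simps inner_commute algebra_simps)

lemma segment_weakly_convex_add_quadratic:
  assumes "segment_weakly_convex \<rho> X h"
  shows "segment_weakly_convex (\<rho> - r) X (\<lambda>y. h y + r / 2 * (norm (y - z))\<^sup>2)"
  unfolding segment_weakly_convex_def
proof (intro ballI)
  fix a b :: 'a and s :: real
  assume ab: "a \<in> X" "b \<in> X" and s: "s \<in> {0..1}"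
  have eq: "(1 - s) *\<^sub>R a + s *\<^sub>R b - z = (1 - s) *\<^sub>R (a - z) + s *\<^sub>R (b - z)"
    by (simp add: algebra_simps)
  show "h ((1 - s) *\<^sub>R a + s *\<^sub>R b) + r / 2 * (norm ((1 - s) *\<^sub>R a + s *\<^sub>R b - z))\<^sup>2
    \<le> (1 - s) * (h a + r / 2 * (norm (a - z))\<^sup>2) + s * (h b + r / 2 * (norm (b - z))\<^sup>2)
      + (\<rho> - r) / 2 * s * (1 - s) * (norm (a - b))\<^sup>2"
    unfolding eq norm_convex_combination_sq
    using segment_weakly_convexD[OF assms ab, of s] s by (simp add: field_simps)
qed

lemma segment_weakly_convex_add_scaled:
  assumes "segment_weakly_convex a X h" "segment_weakly_convex b X k" "0 \<le> \<mu>"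
  shows "segment_weakly_convex (a + \<mu> * b) X (\<lambda>y. h y + \<mu> * k y)"
  unfolding segment_weakly_convex_def
proof (intro ballI)
  fix u v :: 'a and s :: real
  assume uv: "u \<in> X" "v \<in> X" and s: "s \<in> {0..1}"
  show "h ((1 - s) *\<^sub>R u + s *\<^sub>R v) + \<mu> * k ((1 - s) *\<^sub>R u + s *\<^sub>R v)
    \<le> (1 - s) * (h u + \<mu> * k u) + s * (h v + \<mu> * k v)
      + (a + \<mu> * b) / 2 * s * (1 - s) * (norm (u - v))\<^sup>2"
    using segment_weakly_convexD[OF assms(1) uv, of s]
      mult_left_mono[OF segment_weakly_convexD[OF assms(2) uv, of s] assms(3)] s
    by (simp add: field_simps)
qed

text \<open>\<open>x\<close> is compared with the point at fraction \<open>s\<close> of the way to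
  \<open>y\<close>; the gain from strong convexity survives division by \<open>s\<close> and the
  limit.\<close>

lemma minimizer_quadratic_growth:
  assumes "convex X" "segment_weakly_convex (- \<kappa>) X h"
    and min: "x \<in> X" "\<And>y. y \<in> X \<Longrightarrow> h x \<le> h y" and y: "y \<in> X"
  shows "h x + \<kappa> / 2 * (norm (y - x))\<^sup>2 \<le> h y"
proof (rule le_if_le_add_vanishing)
  fix s :: real assume s: "0 < s" "s < 1"
  define D where "D = (norm (y - x))\<^sup>2"
  have "h x \<le> h ((1 - s) *\<^sub>R x + s *\<^sub>R y)"
    by (intro min(2) convex_segment_mem assms) (use s in auto)
  also have "\<dots> \<le> (1 - s) * h x + s * h y + - \<kappa> / 2 * s * (1 - s) * D"
    using segment_weakly_convexD[OF assms(2) min(1) y, of s] s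
    by (simp add: D_def norm_minus_commute)
  finally have "s * (h x + \<kappa> / 2 * D) \<le> s * (h y + s * (\<kappa> / 2 * D))"
    by (simp add: field_simps)
  thus "h x + \<kappa> / 2 * (norm (y - x))\<^sup>2 \<le> h y + s * (\<kappa> / 2 * (norm (y - x))\<^sup>2)"
    using s by (simp add: D_def)
qed

text \<open>Source of the constant \<open>\<nu>\<close>: for \<open>a = \<theta>\<close> and
  \<open>b = \<kappa>\<close> it bounds \<open>\<theta> + \<kappa> / 2 * D\<^sup>2\<close> below by
  \<open>\<nu> * D\<close>, a drop of at least \<open>\<nu>\<close> per unit of distance.\<close>

lemma amgm_sqrt:
  fixes a b D :: real
  assumes "0 \<le> a" "0 \<le> b"
  shows "sqrt (2 * a * b) * D \<le> a + b / 2 * D\<^sup>2"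
proof -
  have "0 \<le> (sqrt a - sqrt (b / 2) * D)\<^sup>2" by simp
  also have "\<dots> = a + b / 2 * D\<^sup>2 - 2 * (sqrt a * sqrt (b / 2)) * D"
    using assms by (simp add: power2_diff power_mult_distrib)
  also have "2 * (sqrt a * sqrt (b / 2)) = sqrt (4 * (a * (b / 2)))"
    by (simp only: real_sqrt_mult real_sqrt_four)
  finally show ?thesis by (simp add: algebra_simps)
qed

text \<open>The multiplier is the smallest slope \<open>(\<phi> y - \<phi> x) / (- \<gamma> y)\<close> over the points with
  \<open>\<gamma> y < 0\<close>.\<close>

lemma convex_multiplier_exists:
  assumes "convex X" "segment_weakly_convex 0 X \<phi>" "segment_weakly_convex 0 X \<gamma>"
    and x: "x \<in> X" "\<gamma> x \<le> 0" and min: "\<And>y. y \<in> X \<Longrightarrow> \<gamma> y \<le> 0 \<Longrightarrow> \<phi> x \<le> \<phi> y"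
    and slater: "y0 \<in> X" "\<gamma> y0 < 0"
  obtains \<mu> where "0 \<le> \<mu>" "\<mu> * \<gamma> x = 0" "\<And>y. y \<in> X \<Longrightarrow> \<phi> x \<le> \<phi> y + \<mu> * \<gamma> y"
proof -
  define R where "R = (\<lambda>y. (\<phi> y - \<phi> x) / (- \<gamma> y)) ` {y \<in> X. \<gamma> y < 0}"
  define \<mu> where "\<mu> = Inf R"
  have ne: "R \<noteq> {}" using slater by (auto simp: R_def)
  have R0: "0 \<le> q" if "q \<in> R" for q
    using that min unfolding R_def by (auto simp: divide_nonneg_neg)
  have bdd: "bdd_below R" using R0 by (rule bdd_belowI)
  have l0: "0 \<le> \<mu>" unfolding \<mu>_def using ne R0 by (rule cInf_greatest)
  have lle: "\<mu> \<le> (\<phi> y - \<phi> x) / (- \<gamma> y)" if "y \<in> X" "\<gamma> y < 0" for y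
    unfolding \<mu>_def by (rule cInf_lower[OF _ bdd]) (use that in \<open>auto simp: R_def\<close>)
  \<comment> \<open>Complementary slackness: if \<open>\<gamma> x < 0\<close>, then \<open>x\<close>
    itself contributes the slope 0 to \<open>R\<close>.\<close>
  have comp: "\<mu> * \<gamma> x = 0" using lle[of x] l0 x by (cases "\<gamma> x < 0") auto
  have "\<phi> x \<le> \<phi> y + \<mu> * \<gamma> y" if y: "y \<in> X" for y
  proof -
    consider "\<gamma> y < 0" | "\<gamma> y = 0" | "\<gamma> y > 0" by linarith
    thus ?thesis
    proof cases
      case 1
      thus ?thesis using lle[OF y 1] by (simp add: field_simps)
    next
      case 2
      thus ?thesis using min[OF y] by simp
    next
      case 3
      have "(\<phi> x - \<phi> y) / \<gamma> y \<le> q" if "q \<in> R" for q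
      proof -
        obtain w where w: "w \<in> X" "\<gamma> w < 0" and q: "q = (\<phi> w - \<phi> x) / (- \<gamma> w)"
          using \<open>q \<in> R\<close> unfolding R_def by auto
        \<comment> \<open>The zero of the linear interpolation of \<open>\<gamma>\<close> from
          \<open>w\<close> to \<open>y\<close>; by convexity the corresponding point is feasible,
          and \<open>x\<close> can be compared with it.\<close>
        define s where "s = - \<gamma> w / (\<gamma> y - \<gamma> w)"
        have s: "0 \<le> s" "s \<le> 1" using w 3 by (auto simp: s_def field_simps)
        have s': "1 - s = \<gamma> y / (\<gamma> y - \<gamma> w)" using w 3 by (simp add: s_def field_simps)
        have mem: "(1 - s) *\<^sub>R w + s *\<^sub>R y \<in> X" using convex_segment_mem assms(1) w y s by blast
        have "\<gamma> ((1 - s) *\<^sub>R w + s *\<^sub>R y) \<le> (1 - s) * \<gamma> w + s * \<gamma> y"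
          using segment_weakly_convexD[OF assms(3) w(1) y s] by simp
        also have "\<dots> = 0" unfolding s' unfolding s_def by (simp add: field_simps)
        finally have "\<phi> x \<le> \<phi> ((1 - s) *\<^sub>R w + s *\<^sub>R y)" by (rule min[OF mem])
        also have "\<dots> \<le> (1 - s) * \<phi> w + s * \<phi> y"
          using segment_weakly_convexD[OF assms(2) w(1) y s] by simp
        also have "\<dots> = (\<gamma> y * \<phi> w - \<gamma> w * \<phi> y) / (\<gamma> y - \<gamma> w)"
          unfolding s' unfolding s_def by (simp add: diff_divide_distrib)
        finally have "\<phi> x * (\<gamma> y - \<gamma> w) \<le> \<gamma> y * \<phi> w - \<gamma> w * \<phi> y"
          using w 3 by (simp add: field_simps)
        thus ?thesis unfolding q using w 3 by (simp add: field_simps)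
      qed
      hence "(\<phi> x - \<phi> y) / \<gamma> y \<le> \<mu>" unfolding \<mu>_def by (rule cInf_greatest[OF ne])
      thus ?thesis using 3 by (simp add: field_simps)
    qed
  qed
  with l0 comp show ?thesis by (rule that)
qed

section \<open>The proximal problem\<close>

text \<open>The real-valued consequences of the hypotheses, with \<open>r\<close> in the role of
  \<open>\<rho>_hat\<close>. Slater's condition is a predicate on the centre \<open>z\<close>
  instead of an assumption, since it is available only where \<open>G z\<close> is small.\<close>

locale prox_problem =
  fixes X :: "'a::euclidean_space set" and F G :: "'a \<Rightarrow> real" and M \<rho> r \<theta> low :: real
  assumes closed: "closed X" and convex: "convex X" and M: "0 < M" and \<rho>: "0 \<le> \<rho>" "\<rho> < r"
    and \<theta>: "0 < \<theta>"
    and F_weak: "segment_weakly_convex \<rho> X F" and G_weak: "segment_weakly_convex \<rho> X G"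
    and F_lip: "\<And>a b. a \<in> X \<Longrightarrow> b \<in> X \<Longrightarrow> F b - F a \<le> M * norm (b - a)"
    and G_lip: "\<And>a b. a \<in> X \<Longrightarrow> b \<in> X \<Longrightarrow> G b - G a \<le> M * norm (b - a)"
    and low: "\<And>y. y \<in> X \<Longrightarrow> low \<le> F y"
begin

definition prox_objective :: "'a \<Rightarrow> 'a \<Rightarrow> real" where
  "prox_objective z y = F y + r / 2 * (norm (y - z))\<^sup>2"

definition prox_constraint :: "'a \<Rightarrow> 'a \<Rightarrow> real" where
  "prox_constraint z y = G y + r / 2 * (norm (y - z))\<^sup>2"

definition is_prox :: "'a \<Rightarrow> 'a \<Rightarrow> bool" where
  "is_prox z p \<longleftrightarrow> p \<in> X \<and> prox_constraint z p \<le> 0 \<and>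
     (\<forall>y\<in>X. prox_constraint z y \<le> 0 \<longrightarrow> prox_objective z p \<le> prox_objective z y)"

definition slater :: "'a \<Rightarrow> bool" where
  "slater z \<longleftrightarrow> (\<exists>y\<in>X. prox_constraint z y \<le> - \<theta>)"

lemma F_continuous: "continuous_on X F" and G_continuous: "continuous_on X G"
proof -
  have "M-lipschitz_on X h" if "\<And>a b. a \<in> X \<Longrightarrow> b \<in> X \<Longrightarrow> h b - h a \<le> M * norm (b - a)"
    for h :: "'a \<Rightarrow> real"
  proof (rule lipschitz_onI)
    fix a b assume "a \<in> X" "b \<in> X"
    thus "dist (h a) (h b) \<le> M * dist a b"
      using that[of a b] that[of b a]
      by (simp add: dist_norm abs_le_iff norm_minus_commute[of a b])
  qed (use M in simp)
  from this[of F] this[of G] have "M-lipschitz_on X F" "M-lipschitz_on X G"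
    using F_lip G_lip by auto
  thus "continuous_on X F" "continuous_on X G" by (auto intro: lipschitz_on_continuous_on)
qed

lemma prox_objective_continuous: "continuous_on X (prox_objective z)"
  and prox_constraint_continuous: "continuous_on X (prox_constraint z)"
  unfolding prox_objective_def prox_constraint_def
  by (intro continuous_intros F_continuous G_continuous)+

text \<open>The lower bound \<open>low\<close> makes the sublevel set of the objective at a feasible
  \<open>y1\<close> bounded, and the feasible set is closed; compactness gives a minimizer.\<close>

lemma prox_exists:
  assumes "slater z"
  shows "\<exists>p. is_prox z p"
proof -
  define K where "K = {y \<in> X. prox_constraint z y \<le> 0}"
  obtain y1 where y1: "y1 \<in> K"
    using assms \<theta> unfolding slater_def K_def by force
  have "K = X \<inter> prox_constraint z -` {..0}" by (auto simp: K_def)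
  hence closedK: "closed K"
    using continuous_closed_preimage[OF prox_constraint_continuous closed, of "{..0}" z] by simp
  define B where "B = sqrt (2 / r * (prox_objective z y1 - low))"
  have r: "0 < r" using \<rho> by linarith
  have inB: "y \<in> cball z B" if "y \<in> X" "prox_objective z y \<le> prox_objective z y1" for y
  proof -
    have "r / 2 * (norm (y - z))\<^sup>2 \<le> prox_objective z y1 - low"
      using that low[OF that(1)] unfolding prox_objective_def by linarith
    hence "(norm (y - z))\<^sup>2 \<le> 2 / r * (prox_objective z y1 - low)"
      using r by (simp add: field_simps)
    hence "norm (y - z) \<le> B" unfolding B_def by (rule real_le_rsqrt)
    thus ?thesis by (simp add: dist_norm norm_minus_commute)
  qed
  have "compact (K \<inter> cball z B)" using closedK by (simp add: closed_Int_compact)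
  moreover have "y1 \<in> K \<inter> cball z B" using y1 inB by (simp add: K_def)
  moreover have "continuous_on (K \<inter> cball z B) (prox_objective z)"
    by (rule continuous_on_subset[OF prox_objective_continuous]) (auto simp: K_def)
  ultimately obtain p where p: "p \<in> K \<inter> cball z B"
    "\<forall>y\<in>K \<inter> cball z B. prox_objective z p \<le> prox_objective z y"
    using continuous_attains_inf[of "K \<inter> cball z B" "prox_objective z"] by blast
  have "prox_objective z p \<le> prox_objective z y" if y: "y \<in> K" for y
  proof (cases "prox_objective z y \<le> prox_objective z y1")
    case True
    thus ?thesis using p(2) inB[of y] y by (auto simp: K_def)
  next
    case False
    moreover have "prox_objective z p \<le> prox_objective z y1"
      using p(2) \<open>y1 \<in> K\<close> inB[of y1] by (auto simp: K_def)
    ultimately show ?thesis by linarith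
  qed
  with p(1) have "is_prox z p" unfolding is_prox_def K_def by auto
  thus ?thesis ..
qed

text \<open>The Lagrangian is minimal at \<open>p\<close> with strong convexity modulus
  \<open>(1 + \<mu>) * (r - \<rho>)\<close>, which gives the growth. The bound on
  \<open>\<mu>\<close> comes from moving \<open>p\<close> towards the Slater point: the rise of the
  objective is of first order at most \<open>2 * M * D\<close> and must outweigh
  \<open>\<mu>\<close> times the fall of the constraint.\<close>

lemma prox_multiplier:
  assumes sl: "slater z" and z: "z \<in> X" and p: "is_prox z p"
  obtains \<mu> where "0 \<le> \<mu>" "\<mu> \<le> 2 * M / sqrt (2 * \<theta> * (r - \<rho>))"
    "\<And>y. y \<in> X \<Longrightarrow> prox_objective z p + (1 + \<mu>) * (r - \<rho>) / 2 * (norm (y - p))\<^sup>2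
       \<le> prox_objective z y + \<mu> * prox_constraint z y"
proof -
  let ?\<phi> = "prox_objective z" and ?\<gamma> = "prox_constraint z"
  define \<kappa> where "\<kappa> = r - \<rho>"
  have \<kappa>: "0 < \<kappa>" and r: "0 < r" using \<rho> by (auto simp: \<kappa>_def)
  obtain y0 where y0: "y0 \<in> X" "?\<gamma> y0 \<le> - \<theta>" using sl unfolding slater_def by blast
  have pX: "p \<in> X" using p by (simp add: is_prox_def)
  have \<phi>_strong: "segment_weakly_convex (- \<kappa>) X ?\<phi>"
    using segment_weakly_convex_add_quadratic[OF F_weak, of r z]
    unfolding prox_objective_def \<kappa>_def by simp
  have \<gamma>_strong: "segment_weakly_convex (- \<kappa>) X ?\<gamma>"
    using segment_weakly_convex_add_quadratic[OF G_weak, of r z]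
    unfolding prox_constraint_def \<kappa>_def by simp
  have weaken: "segment_weakly_convex 0 X h" if "segment_weakly_convex (- \<kappa>) X h" for h
    unfolding segment_weakly_convex_def
  proof (intro ballI)
    fix a b and s :: real assume ab: "a \<in> X" "b \<in> X" and s: "s \<in> {0..1}"
    have "0 \<le> \<kappa> / 2 * s * (1 - s) * (norm (a - b))\<^sup>2" using s \<kappa> by auto
    thus "h ((1 - s) *\<^sub>R a + s *\<^sub>R b)
        \<le> (1 - s) * h a + s * h b + 0 / 2 * s * (1 - s) * (norm (a - b))\<^sup>2"
      using segment_weakly_convexD[OF that ab, of s] s by auto
  qed
  obtain \<mu> where \<mu>: "0 \<le> \<mu>" "\<mu> * ?\<gamma> p = 0" "\<And>y. y \<in> X \<Longrightarrow> ?\<phi> p \<le> ?\<phi> y + \<mu> * ?\<gamma> y"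
    using convex_multiplier_exists[OF convex weaken[OF \<phi>_strong] weaken[OF \<gamma>_strong], of p y0]
      p y0 \<theta> unfolding is_prox_def by auto
  have L: "segment_weakly_convex (- ((1 + \<mu>) * \<kappa>)) X (\<lambda>y. ?\<phi> y + \<mu> * ?\<gamma> y)"
    using segment_weakly_convex_add_scaled[OF \<phi>_strong \<gamma>_strong \<mu>(1)] by (simp add: algebra_simps)
  have growth: "?\<phi> p + (1 + \<mu>) * \<kappa> / 2 * (norm (y - p))\<^sup>2 \<le> ?\<phi> y + \<mu> * ?\<gamma> y" if "y \<in> X" for y
    using minimizer_quadratic_growth[OF convex L pX _ that] \<mu> by simp
  define E where "E = norm (p - z)"
  \<comment> \<open>Moving \<open>p\<close> towards \<open>z\<close> lowers both quadratic penalties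
    at rate \<open>r * E * E\<close>, while \<open>F\<close> and \<open>G\<close> rise at rate at
    most \<open>M * E\<close>; minimality of the Lagrangian at \<open>p\<close> forces the
    inequality.\<close>
  have rE: "r * E \<le> M"
  proof (cases "E = 0")
    case False
    hence E: "0 < E" by (simp add: E_def)
    have "r * E \<le> M"
    proof (rule le_if_le_add_vanishing)
      fix s :: real assume s: "0 < s" "s < 1"
      define y where "y = (1 - s) *\<^sub>R p + s *\<^sub>R z"
      have y: "y \<in> X" unfolding y_def by (intro convex_segment_mem convex pX z) (use s in auto)
      have yp: "y - p = s *\<^sub>R (z - p)" and yz: "y - z = (1 - s) *\<^sub>R (p - z)"
        unfolding y_def by (simp_all add: algebra_simps)
      have n1: "norm (y - p) = s * E" unfolding yp E_def using s by (simp add: norm_minus_commute)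
      have n2: "norm (y - z) = (1 - s) * E" unfolding yz E_def using s by simp
      have q: "r / 2 * ((1 - s) * E)\<^sup>2 = r / 2 * E\<^sup>2 + s * E * (s * (r * E / 2) - r * E)"
        by (simp add: power2_eq_square field_simps)
      define w where "w = s * E * (M + s * (r * E / 2) - r * E)"
      have "?\<phi> y \<le> ?\<phi> p + w"
        using F_lip[OF pX y] unfolding prox_objective_def n1 n2 q E_def[symmetric] w_def
        by (simp add: algebra_simps)
      moreover have "?\<gamma> y \<le> ?\<gamma> p + w"
        using G_lip[OF pX y] unfolding prox_constraint_def n1 n2 q E_def[symmetric] w_def
        by (simp add: algebra_simps)
      hence "\<mu> * ?\<gamma> y \<le> \<mu> * ?\<gamma> p + \<mu> * w"
        unfolding distrib_left[symmetric] using \<mu>(1) by (rule mult_left_mono)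
      ultimately have "0 \<le> w + \<mu> * w" using \<mu>(3)[OF y] \<mu>(2) by linarith
      hence "0 \<le> (1 + \<mu>) * (s * E) * (M + s * (r * E / 2) - r * E)"
        by (simp add: w_def distrib_right mult.assoc)
      moreover have "0 < (1 + \<mu>) * (s * E)" using \<mu>(1) s E by simp
      ultimately have "0 \<le> M + s * (r * E / 2) - r * E"
        using mult_pos_neg linorder_not_le by blast
      thus "r * E \<le> M + s * (r * E / 2)" by simp
    qed
    thus ?thesis .
  qed (use M in auto)
  define D where "D = norm (y0 - p)"
  have D0: "0 \<le> D" by (simp add: D_def)
  \<comment> \<open>One \<open>M\<close> is the Lipschitz constant of \<open>F\<close>, the other
    comes from \<open>rE\<close>, which bounds the slope of the quadratic penalty. Complementary
    slackness removes the term in \<open>?\<gamma> p\<close>.\<close>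
  have "\<mu> * (\<theta> + \<kappa> / 2 * D\<^sup>2) \<le> 2 * M * D"
  proof (rule le_if_le_add_vanishing)
    fix s :: real assume s: "0 < s" "s < 1"
    define y where "y = (1 - s) *\<^sub>R p + s *\<^sub>R y0"
    have y: "y \<in> X" unfolding y_def by (intro convex_segment_mem convex pX y0) (use s in auto)
    have yp: "y - p = s *\<^sub>R (y0 - p)" and yz: "y - z = (p - z) + s *\<^sub>R (y0 - p)"
      unfolding y_def by (simp_all add: algebra_simps)
    have n1: "norm (y - p) = s * D" unfolding yp D_def using s by simp
    have n2: "norm (y - z) \<le> E + s * D"
      unfolding yz E_def D_def using norm_triangle_ineq[of "p - z" "s *\<^sub>R (y0 - p)"] s by simp
    have "r / 2 * (norm (y - z))\<^sup>2 \<le> r / 2 * (E + s * D)\<^sup>2"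
      using n2 r by (intro mult_left_mono power_mono) auto
    also have "\<dots> = r / 2 * E\<^sup>2 + s * D * (r * E) + s * s * (r / 2 * D\<^sup>2)"
      by (simp add: power2_eq_square field_simps)
    also have "\<dots> \<le> r / 2 * E\<^sup>2 + s * D * M + s * s * (r / 2 * D\<^sup>2)"
      using mult_left_mono[OF rE, of "s * D"] s D0 by simp
    finally have "?\<phi> y \<le> ?\<phi> p + s * (2 * M * D + s * (r / 2 * D\<^sup>2))"
      using F_lip[OF pX y] unfolding prox_objective_def n1 E_def[symmetric]
      by (simp add: algebra_simps)
    moreover have "\<mu> * ?\<gamma> y \<le> - s * (\<mu> * (\<theta> + \<kappa> / 2 * D\<^sup>2)) + s * s * (\<mu> * \<kappa> / 2 * D\<^sup>2)"
    proof -
      have "?\<gamma> y \<le> (1 - s) * ?\<gamma> p + s * ?\<gamma> y0 - \<kappa> / 2 * s * (1 - s) * D\<^sup>2"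
        using segment_weakly_convexD[OF \<gamma>_strong pX y0(1), of s] s
        unfolding y_def D_def by (simp add: norm_minus_commute)
      also have "\<dots> \<le> (1 - s) * ?\<gamma> p + s * (- \<theta>) - \<kappa> / 2 * s * (1 - s) * D\<^sup>2"
        using mult_left_mono[OF y0(2), of s] s by simp
      finally have "\<mu> * ?\<gamma> y \<le> \<mu> * ((1 - s) * ?\<gamma> p + s * (- \<theta>) - \<kappa> / 2 * s * (1 - s) * D\<^sup>2)"
        using \<mu>(1) by (rule mult_left_mono)
      also have "\<dots> = (1 - s) * (\<mu> * ?\<gamma> p) - s * (\<mu> * (\<theta> + \<kappa> / 2 * D\<^sup>2)) + s * s * (\<mu> * \<kappa> / 2 * D\<^sup>2)"
        by (simp add: field_simps)
      finally show ?thesis using \<mu>(2) by simp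
    qed
    ultimately have "s * (\<mu> * (\<theta> + \<kappa> / 2 * D\<^sup>2)) \<le> s * (2 * M * D + s * (r / 2 * D\<^sup>2 + \<mu> * \<kappa> / 2 * D\<^sup>2))"
      using \<mu>(3)[OF y] by (simp add: algebra_simps)
    thus "\<mu> * (\<theta> + \<kappa> / 2 * D\<^sup>2) \<le> 2 * M * D + s * (r / 2 * D\<^sup>2 + \<mu> * \<kappa> / 2 * D\<^sup>2)"
      using s by simp
  qed
  note key = this
  define \<nu> where "\<nu> = sqrt (2 * \<theta> * \<kappa>)"
  have \<nu>: "0 < \<nu>" using \<theta> \<kappa> by (simp add: \<nu>_def)
  have "\<mu> \<le> 2 * M / \<nu>"
  proof (cases "D = 0")
    case True
    hence "\<mu> * \<theta> \<le> 0" using key by simp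
    hence "\<mu> = 0" using \<mu>(1) \<theta> by (simp add: mult_le_0_iff)
    thus ?thesis using M \<nu> by simp
  next
    case False
    have "\<mu> * (\<nu> * D) \<le> \<mu> * (\<theta> + \<kappa> / 2 * D\<^sup>2)"
      unfolding \<nu>_def using \<mu>(1) \<theta> \<kappa> by (intro mult_left_mono amgm_sqrt) auto
    hence "\<mu> * \<nu> * D \<le> 2 * M * D" using key by simp
    hence "\<mu> * \<nu> \<le> 2 * M" using False D0 by simp
    thus ?thesis using \<nu> by (simp add: field_simps)
  qed
  with \<mu>(1) growth show ?thesis unfolding \<kappa>_def \<nu>_def by (intro that) auto
qed

text \<open>On the segment from \<open>z\<close> to a Slater point, strong convexity of the
  constraint and \<open>amgm_sqrt\<close> give the upper bound
  \<open>(1 - s) * (G z - s * (\<nu> * D))\<close>. Travelling the distance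
  \<open>G z / \<nu>\<close> thus reaches a feasible point, unless the Slater point is already that
  near.\<close>

lemma error_bound:
  assumes sl: "slater z" and z: "z \<in> X" and pos: "0 < G z"
  shows "\<exists>p\<in>X. G p \<le> 0 \<and> norm (z - p) \<le> G z / sqrt (2 * \<theta> * (r - \<rho>))"
proof -
  let ?\<gamma> = "prox_constraint z"
  define \<kappa> \<nu> where "\<kappa> = r - \<rho>" and "\<nu> = sqrt (2 * \<theta> * \<kappa>)"
  have \<kappa>: "0 < \<kappa>" and r: "0 < r" using \<rho> by (auto simp: \<kappa>_def)
  have \<nu>: "0 < \<nu>" using \<theta> \<kappa> by (simp add: \<nu>_def)
  obtain y0 where y0: "y0 \<in> X" "?\<gamma> y0 \<le> - \<theta>" using sl unfolding slater_def by blast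
  have G_le: "G y \<le> ?\<gamma> y" for y unfolding prox_constraint_def using r by simp
  define D where "D = norm (z - y0)"
  show ?thesis
  proof (cases "D \<le> G z / \<nu>")
    case True
    thus ?thesis using y0 G_le[of y0] \<theta> unfolding D_def \<nu>_def \<kappa>_def by (intro bexI[of _ y0]) auto
  next
    case False
    have "0 < G z / \<nu>" using pos \<nu> by simp
    with False have D: "0 < D" by linarith
    define s where "s = G z / \<nu> / D"
    have s: "0 < s" "s < 1" using False D pos \<nu> by (auto simp: s_def field_simps)
    define y where "y = (1 - s) *\<^sub>R z + s *\<^sub>R y0"
    have y: "y \<in> X" unfolding y_def by (intro convex_segment_mem convex z y0) (use s in auto)
    have "?\<gamma> y \<le> (1 - s) * ?\<gamma> z + s * ?\<gamma> y0 - \<kappa> / 2 * s * (1 - s) * D\<^sup>2"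
      using segment_weakly_convexD[OF segment_weakly_convex_add_quadratic[OF G_weak, of r z] z y0(1), of s] s
      unfolding prox_constraint_def \<kappa>_def y_def D_def by (simp add: field_simps)
    also have "\<dots> \<le> (1 - s) * G z + (1 - s) * (s * (- \<theta>)) - \<kappa> / 2 * s * (1 - s) * D\<^sup>2"
    proof -
      have "s * ?\<gamma> y0 \<le> s * (- \<theta>)" using y0(2) s by (intro mult_left_mono) auto
      \<comment> \<open>Part of the drop is given up so that \<open>1 - s\<close> factors out of the
        whole bound.\<close>
      also have "\<dots> \<le> (1 - s) * (s * (- \<theta>))" using s \<theta> by (simp add: algebra_simps)
      finally show ?thesis by (simp add: prox_constraint_def)
    qed
    also have "\<dots> = (1 - s) * (G z - s * (\<theta> + \<kappa> / 2 * D\<^sup>2))" by (simp add: algebra_simps)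
    also have "\<dots> \<le> (1 - s) * (G z - s * (\<nu> * D))"
      unfolding \<nu>_def using s \<theta> \<kappa>
      by (intro mult_left_mono diff_left_mono amgm_sqrt) auto
    also have "s * (\<nu> * D) = G z" unfolding s_def using \<nu> D by simp
    finally have "G y \<le> 0" using G_le[of y] by simp
    moreover have "z - y = s *\<^sub>R (z - y0)" unfolding y_def by (simp add: algebra_simps)
    hence "norm (z - y) = G z / \<nu>" using s D by (simp add: D_def[symmetric]) (simp add: s_def)
    ultimately show ?thesis using y unfolding \<nu>_def \<kappa>_def by (intro bexI[of _ y]) auto
  qed
qed

end

section \<open>The switching subgradient run\<close>

lemma projected_step:
  fixes X :: "'a::euclidean_space set"
  assumes "closed X" "convex X" "p \<in> X"
  shows "(norm (closest_point X (z - c *\<^sub>R \<zeta>) - p))\<^sup>2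
    \<le> (norm (z - p))\<^sup>2 - 2 * c * (\<zeta> \<bullet> (z - p)) + c\<^sup>2 * (norm \<zeta>)\<^sup>2"
proof -
  have "norm (closest_point X (z - c *\<^sub>R \<zeta>) - p) \<le> norm (z - c *\<^sub>R \<zeta> - p)"
    using closest_point_lipschitz[OF assms(2,1), of "z - c *\<^sub>R \<zeta>" p] assms(3)
    by (auto simp: dist_norm closest_point_self)
  hence "(norm (closest_point X (z - c *\<^sub>R \<zeta>) - p))\<^sup>2 \<le> (norm (z - p - c *\<^sub>R \<zeta>))\<^sup>2"
    by (intro power_mono) (auto simp: algebra_simps)
  also have "\<dots> = (norm (z - p))\<^sup>2 - 2 * c * (\<zeta> \<bullet> (z - p)) + c\<^sup>2 * (norm \<zeta>)\<^sup>2"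
    unfolding power2_norm_eq_inner by (simp add: inner_simps inner_commute power2_eq_square algebra_simps)
  finally show ?thesis .
qed

section \<open>Effect of a single step on distances and on the proximal value\<close>

context prox_problem
begin

text \<open>\<open>\<kappa>\<close> is the strong convexity modulus of both proximal functions,
  \<open>\<nu>\<close> the slope in \<open>error_bound\<close>, \<open>\<Lambda>\<close> the
  multiplier bound of \<open>prox_multiplier\<close>.\<close>

definition \<kappa> :: real where "\<kappa> = r - \<rho>"
definition \<nu> :: real where "\<nu> = sqrt (2 * \<theta> * (r - \<rho>))"
definition \<Lambda> :: real where "\<Lambda> = 2 * M / \<nu>"

definition weak_subgradient :: "('a \<Rightarrow> real) \<Rightarrow> 'a \<Rightarrow> 'a \<Rightarrow> bool" where
  "weak_subgradient h z \<zeta> \<longleftrightarrow> (\<forall>w\<in>X. h z + \<zeta> \<bullet> (w - z) - \<rho> / 2 * (norm (w - z))\<^sup>2 \<le> h w)"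

lemma constants_pos: "0 < \<kappa>" "0 < \<nu>" "0 < \<Lambda>" "0 < r"
  using \<rho> \<theta> M by (auto simp: \<kappa>_def \<nu>_def \<Lambda>_def)

text \<open>Weak duality at the new centre \<open>z'\<close>, tested at the old proximal point
  \<open>p\<close>. Since \<open>p\<close> is feasible for \<open>z\<close>, only the change of the
  quadratic term counts; it enters objective and constraint alike, whence the factor
  \<open>1 + \<mu>\<close>.\<close>

lemma prox_potential_change:
  assumes "slater z'" "z' \<in> X" "is_prox z p" "is_prox z' p'"
  obtains \<mu> where "0 \<le> \<mu>" "\<mu> \<le> \<Lambda>"
    "prox_objective z' p' \<le> prox_objective z p
       + (1 + \<mu>) * (r / 2 * ((norm (p - z'))\<^sup>2 - (norm (p - z))\<^sup>2))"
proof -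
  have pX: "p \<in> X" and feas: "prox_constraint z p \<le> 0" using assms by (auto simp: is_prox_def)
  define c where "c = r / 2 * ((norm (p - z'))\<^sup>2 - (norm (p - z))\<^sup>2)"
  obtain \<mu> where \<mu>: "0 \<le> \<mu>" "\<mu> \<le> 2 * M / sqrt (2 * \<theta> * (r - \<rho>))"
    and lag: "\<And>y. y \<in> X \<Longrightarrow> prox_objective z' p' + (1 + \<mu>) * (r - \<rho>) / 2 * (norm (y - p'))\<^sup>2
       \<le> prox_objective z' y + \<mu> * prox_constraint z' y"
    using prox_multiplier[OF assms(1,2,4)] by blast
  have "0 \<le> (1 + \<mu>) * (r - \<rho>) / 2 * (norm (p - p'))\<^sup>2" using \<mu>(1) \<rho> by simp
  with lag[OF pX] have "prox_objective z' p' \<le> prox_objective z' p + \<mu> * prox_constraint z' p"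
    by linarith
  also have "prox_objective z' p = prox_objective z p + c"
    by (simp add: prox_objective_def c_def algebra_simps)
  also have "prox_constraint z' p = prox_constraint z p + c"
    by (simp add: prox_constraint_def c_def algebra_simps)
  also have "\<mu> * (prox_constraint z p + c) \<le> \<mu> * c"
    using feas \<mu>(1) by (intro mult_left_mono) auto
  finally have "prox_objective z' p' \<le> prox_objective z p + (1 + \<mu>) * c"
    by (simp add: distrib_right)
  moreover have "\<mu> \<le> \<Lambda>" using \<mu>(2) by (simp add: \<Lambda>_def \<nu>_def)
  ultimately show ?thesis using \<mu>(1) unfolding c_def by (intro that)
qed

text \<open>Testing the growth inequality at \<open>z\<close>, where both quadratics vanish, and
  using the subgradient inequality gives \<open>\<zeta> \<bullet> (z - p) \<ge> \<kappa> * d -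
  \<Lambda> * tol\<close>.\<close>

lemma objective_step_distance:
  assumes sl: "slater z" and z: "z \<in> X" and p: "is_prox z p"
    and sub: "weak_subgradient F z \<zeta>" "norm \<zeta> \<le> M"
    and tol: "G z \<le> tol" "0 \<le> tol" "c = tol / M\<^sup>2"
  shows "(norm (p - closest_point X (z - c *\<^sub>R \<zeta>)))\<^sup>2 - (norm (p - z))\<^sup>2
    \<le> c * (tol * (1 + 2 * \<Lambda>) - \<kappa> * (norm (p - z))\<^sup>2)"
proof -
  define d where "d = (norm (p - z))\<^sup>2"
  have pX: "p \<in> X" using p by (simp add: is_prox_def)
  have c: "0 \<le> c" using tol by simp
  obtain \<mu> where \<mu>: "0 \<le> \<mu>" "\<mu> \<le> 2 * M / sqrt (2 * \<theta> * (r - \<rho>))"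
    and growth: "\<And>y. y \<in> X \<Longrightarrow> prox_objective z p + (1 + \<mu>) * (r - \<rho>) / 2 * (norm (y - p))\<^sup>2
       \<le> prox_objective z y + \<mu> * prox_constraint z y"
    using prox_multiplier[OF sl z p] by blast
  have \<mu>\<Lambda>: "\<mu> \<le> \<Lambda>" using \<mu>(2) by (simp add: \<Lambda>_def \<nu>_def)
  have lag: "prox_objective z p + (1 + \<mu>) * \<kappa> / 2 * d \<le> prox_objective z z + \<mu> * prox_constraint z z"
    using growth[OF z] by (simp add: \<kappa>_def d_def norm_minus_commute)
  have "\<mu> * G z \<le> \<Lambda> * tol"
    using mult_left_mono[OF tol(1) \<mu>(1)] mult_right_mono[OF \<mu>\<Lambda> tol(2)] by linarith
  moreover have "F z - \<zeta> \<bullet> (z - p) - \<rho> / 2 * d \<le> F p"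
    using sub(1) pX unfolding weak_subgradient_def d_def by (force simp: inner_diff_right)
  moreover have "0 \<le> \<mu> * (\<kappa> / 2 * d)" using \<mu> constants_pos by (simp add: d_def)
  ultimately have inner: "\<zeta> \<bullet> (z - p) \<ge> \<kappa> * d - \<Lambda> * tol"
    using lag by (simp add: prox_objective_def prox_constraint_def d_def[symmetric] \<kappa>_def field_simps)
  have "c\<^sup>2 * (norm \<zeta>)\<^sup>2 \<le> c\<^sup>2 * M\<^sup>2"
    using sub(2) by (intro mult_left_mono power_mono) auto
  also have "\<dots> = c * tol" using tol(3) M by (simp add: power2_eq_square)
  finally have "(norm (closest_point X (z - c *\<^sub>R \<zeta>) - p))\<^sup>2
      \<le> d - 2 * c * (\<zeta> \<bullet> (z - p)) + c * tol"
    using projected_step[OF closed convex pX, of z c \<zeta>] by (simp add: d_def norm_minus_commute)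
  also have "\<dots> \<le> d - 2 * c * (\<kappa> * d - \<Lambda> * tol) + c * tol"
    using mult_left_mono[OF inner, of "2 * c"] c by simp
  \<comment> \<open>One of two copies of \<open>c * (\<kappa> * d)\<close> is given up, so that the
    decrease has the same coefficient as in a constraint step.\<close>
  also have "\<dots> \<le> d + c * (tol * (1 + 2 * \<Lambda>) - \<kappa> * d)"
  proof -
    have "0 \<le> c * (\<kappa> * d)" using c constants_pos by (simp add: d_def)
    thus ?thesis by (simp add: algebra_simps)
  qed
  finally show ?thesis by (simp add: d_def norm_minus_commute)
qed

text \<open>The Polyak stepsize makes the second-order term
  \<open>c\<^sup>2 * (norm \<zeta>)\<^sup>2\<close> equal to \<open>c * G z\<close>, half of the
  first-order gain \<open>2 * c * G z\<close>.\<close>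

lemma polyak_step_distance:
  assumes "p \<in> X" and sub: "weak_subgradient G z \<zeta>" and "0 \<le> G z" "\<zeta> \<noteq> 0"
    and c: "c = G z / (norm \<zeta>)\<^sup>2"
  shows "(norm (closest_point X (z - c *\<^sub>R \<zeta>) - p))\<^sup>2
    \<le> (norm (z - p))\<^sup>2 - c * (G z - 2 * G p - \<rho> * (norm (z - p))\<^sup>2)"
proof -
  have c0: "0 \<le> c" using assms by simp
  have "\<zeta> \<bullet> (z - p) \<ge> G z - G p - \<rho> / 2 * (norm (z - p))\<^sup>2"
    using sub assms(1) inner_minus_right[of \<zeta> "z - p"]
    unfolding weak_subgradient_def by (force simp: norm_minus_commute)
  hence "c * (\<zeta> \<bullet> (z - p)) \<ge> c * (G z - G p - \<rho> / 2 * (norm (z - p))\<^sup>2)"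
    using c0 by (rule mult_left_mono)
  moreover have "c\<^sup>2 * (norm \<zeta>)\<^sup>2 = c * G z"
    using assms(4) unfolding c by (simp add: power2_eq_square)
  ultimately show ?thesis
    using projected_step[OF closed convex assms(1), of z c \<zeta>] by (simp add: algebra_simps)
qed

text \<open>Keeps the Polyak stepsize from dividing by zero: \<open>\<zeta> = 0\<close> would make
  \<open>prox_constraint z\<close> nonnegative on all of \<open>X\<close>, against the Slater
  point.\<close>

lemma constraint_subgradient_nonzero:
  assumes "slater z" "weak_subgradient G z \<zeta>" "0 \<le> G z"
  shows "\<zeta> \<noteq> 0"
proof
  assume "\<zeta> = 0"
  obtain y where y: "y \<in> X" "prox_constraint z y \<le> - \<theta>" using assms(1) by (auto simp: slater_def)
  have "G z - \<rho> / 2 * (norm (y - z))\<^sup>2 \<le> G y"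
    using assms(2) y(1) \<open>\<zeta> = 0\<close> by (auto simp: weak_subgradient_def)
  moreover have "\<rho> / 2 * (norm (y - z))\<^sup>2 \<le> r / 2 * (norm (y - z))\<^sup>2"
    using \<rho> by (intro mult_right_mono) auto
  ultimately show False using y(2) assms(3) \<theta> unfolding prox_constraint_def by linarith
qed

text \<open>Feasibility of \<open>p\<close> in the proximal problem gives
  \<open>- 2 * G p \<ge> r * (norm (p - z))\<^sup>2\<close>, which exceeds the loss from weak
  convexity by the margin \<open>\<kappa>\<close>.\<close>

lemma constraint_step_distance:
  assumes sl: "slater z" and p: "is_prox z p"
    and sub: "weak_subgradient G z \<zeta>" and G: "0 \<le> G z" and c: "c = G z / (norm \<zeta>)\<^sup>2"
  shows "(norm (p - closest_point X (z - c *\<^sub>R \<zeta>)))\<^sup>2 - (norm (p - z))\<^sup>2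
    \<le> - c * (\<kappa> * (norm (p - z))\<^sup>2)"
proof -
  have pX: "p \<in> X" and Gp: "G p \<le> - r / 2 * (norm (p - z))\<^sup>2"
    using p by (auto simp: is_prox_def prox_constraint_def)
  have "\<kappa> * (norm (p - z))\<^sup>2 \<le> G z - 2 * G p - \<rho> * (norm (z - p))\<^sup>2"
    using Gp G by (simp add: \<kappa>_def norm_minus_commute algebra_simps)
  hence "c * (\<kappa> * (norm (p - z))\<^sup>2) \<le> c * (G z - 2 * G p - \<rho> * (norm (z - p))\<^sup>2)"
    using c G by (intro mult_left_mono) auto
  thus ?thesis
    using polyak_step_distance[OF pX sub G constraint_subgradient_nonzero[OF sl sub G] c]
    by (simp add: norm_minus_commute)
qed

text \<open>By the error bound the tolerance \<open>\<nu> / 4 * m\<close> puts \<open>z\<close>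
  within \<open>m / 4\<close> of a feasible point, and the step has length at most
  \<open>m / 4\<close> because \<open>\<nu> \<le> M\<close>.\<close>

lemma objective_step_near_feasible:
  assumes sl: "slater z" and z: "z \<in> X" and \<zeta>: "norm \<zeta> \<le> M"
    and m: "0 < m" and \<nu>M: "\<nu> \<le> M"
    and G: "G z \<le> \<nu> / 4 * m" and c: "c = \<nu> / 4 * m / M\<^sup>2"
  shows "\<exists>p\<in>X. G p \<le> 0 \<and> norm (closest_point X (z - c *\<^sub>R \<zeta>) - p) \<le> m"
proof -
  have "\<exists>p\<in>X. G p \<le> 0 \<and> norm (z - p) \<le> m / 4"
  proof (cases "G z \<le> 0")
    case True
    thus ?thesis using z m by (intro bexI[of _ z]) auto
  next
    case False
    have "G z / \<nu> \<le> m / 4" using G constants_pos by (simp add: field_simps)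
    moreover obtain p where p: "p \<in> X" "G p \<le> 0" "norm (z - p) \<le> G z / \<nu>"
      using error_bound[OF sl z] False unfolding \<nu>_def by auto
    ultimately have "norm (z - p) \<le> m / 4" by linarith
    thus ?thesis using p by blast
  qed
  then obtain p where p: "p \<in> X" "G p \<le> 0" "norm (z - p) \<le> m / 4" by blast
  have c0: "0 \<le> c" using c m constants_pos by simp
  have "norm (closest_point X (z - c *\<^sub>R \<zeta>) - p) \<le> norm (z - c *\<^sub>R \<zeta> - p)"
    using closest_point_lipschitz[OF convex closed, of "z - c *\<^sub>R \<zeta>" p] p
    by (auto simp: dist_norm closest_point_self)
  also have "\<dots> = norm ((z - p) - c *\<^sub>R \<zeta>)" by (simp add: algebra_simps)
  also have "\<dots> \<le> norm (z - p) + c * norm \<zeta>"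
    using norm_triangle_ineq4[of "z - p" "c *\<^sub>R \<zeta>"] c0 by simp
  also have "c * norm \<zeta> \<le> c * M" using \<zeta> c0 by (rule mult_left_mono)
  also have "c * M = \<nu> / M * (m / 4)" using M by (simp add: c power2_eq_square)
  also have "\<dots> \<le> 1 * (m / 4)" using \<nu>M M m by (intro mult_right_mono) auto
  finally show ?thesis using p m by (intro bexI[of _ p]) auto
qed

text \<open>For a suitable feasible \<open>p\<close>, \<open>\<rho> * (norm (z - p))\<^sup>2 \<le>
  \<nu> * norm (z - p) \<le> G z\<close>, so the Polyak step does not increase the distance to
  \<open>p\<close>.\<close>

lemma constraint_step_near_feasible:
  assumes sl: "slater z" and z: "z \<in> X" and sub: "weak_subgradient G z \<zeta>"
    and \<rho>m: "\<rho> * m \<le> \<nu>"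
    and near: "\<exists>p\<in>X. G p \<le> 0 \<and> norm (z - p) \<le> m"
    and G: "0 < G z" and c: "c = G z / (norm \<zeta>)\<^sup>2"
  shows "\<exists>p\<in>X. G p \<le> 0 \<and> norm (closest_point X (z - c *\<^sub>R \<zeta>) - p) \<le> m"
proof -
  \<comment> \<open>Of the point from \<open>near\<close> and the point from the error bound, the
    one closer to \<open>z\<close> satisfies both bounds.\<close>
  obtain p where p: "p \<in> X" "G p \<le> 0" "norm (z - p) \<le> m" "norm (z - p) \<le> G z / \<nu>"
    using near error_bound[OF sl z G] unfolding \<nu>_def by (meson linorder_linear order_trans)
  have "\<rho> * (norm (z - p))\<^sup>2 = \<rho> * norm (z - p) * norm (z - p)" by (simp add: power2_eq_square)
  also have "\<dots> \<le> \<nu> * norm (z - p)"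
    using p(3) \<rho>(1) \<rho>m by (intro mult_right_mono) (auto intro: order_trans[OF mult_left_mono])
  also have "\<dots> \<le> G z" using p(4) constants_pos by (simp add: field_simps)
  finally have "0 \<le> c * (G z - 2 * G p - \<rho> * (norm (z - p))\<^sup>2)" using p(2) c G by simp
  hence "(norm (closest_point X (z - c *\<^sub>R \<zeta>) - p))\<^sup>2 \<le> (norm (z - p))\<^sup>2"
    using polyak_step_distance[OF p(1) sub _ constraint_subgradient_nonzero[OF sl sub] c] G by linarith
  hence "norm (closest_point X (z - c *\<^sub>R \<zeta>) - p) \<le> m"
    using p(3) by (meson norm_ge_zero order_trans power2_le_imp_le)
  thus ?thesis using p by blast
qed

end

section \<open>The feasibility invariant and telescoping along the run\<close>

locale switching_run = prox_problem +
  fixes m tol :: real and x \<zeta> :: "nat \<Rightarrow> 'a" and \<eta> :: "nat \<Rightarrow> real" and T :: nat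
  assumes m: "0 < m" "\<rho> * m \<le> \<nu>" and tol: "tol = \<nu> / 4 * m" and \<nu>M: "\<nu> \<le> M"
    and slater: "\<And>z. z \<in> X \<Longrightarrow> G z \<le> M * m \<Longrightarrow> slater z"
    and x0: "x 0 \<in> X" "G (x 0) \<le> 0"
    and \<zeta>: "\<And>t. t < T \<Longrightarrow> norm (\<zeta> t) \<le> M"
    and step: "\<And>t. t < T \<Longrightarrow> x (Suc t) = closest_point X (x t - \<eta> t *\<^sub>R \<zeta> t)"
    and objective_step: "\<And>t. t < T \<Longrightarrow> G (x t) \<le> tol \<Longrightarrow>
      weak_subgradient F (x t) (\<zeta> t) \<and> \<eta> t = tol / M\<^sup>2"
    and constraint_step: "\<And>t. t < T \<Longrightarrow> tol < G (x t) \<Longrightarrow>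
      weak_subgradient G (x t) (\<zeta> t) \<and> \<eta> t = G (x t) / (norm (\<zeta> t))\<^sup>2"
begin

lemma tol_pos: "0 < tol"
  unfolding tol using m constants_pos by simp

lemma near_feasible_imp:
  assumes "z \<in> X" "\<exists>p\<in>X. G p \<le> 0 \<and> norm (z - p) \<le> m"
  shows "G z \<le> M * m"
proof -
  obtain p where p: "p \<in> X" "G p \<le> 0" "norm (z - p) \<le> m" using assms by blast
  have "G z \<le> G p + M * norm (z - p)" using G_lip[OF p(1) assms(1)] by simp
  thus ?thesis using mult_left_mono[OF p(3), of M] M p(2) by linarith
qed

text \<open>Nearness to a feasible point yields Slater's condition at \<open>x t\<close>, which the
  next step requires, so the invariant sustains itself. The index \<open>T\<close> is included
  because the telescoped potential ends at \<open>x T\<close>.\<close>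

lemma iterate_near_feasible:
  "t \<le> T \<Longrightarrow> x t \<in> X \<and> (\<exists>p\<in>X. G p \<le> 0 \<and> norm (x t - p) \<le> m)"
proof (induction t)
  case 0
  show ?case using x0 m by (auto intro!: bexI[of _ "x 0"])
next
  case (Suc t)
  hence t: "t < T" and IH: "x t \<in> X" "\<exists>p\<in>X. G p \<le> 0 \<and> norm (x t - p) \<le> m" by auto
  have sl: "slater (x t)" using slater near_feasible_imp IH by blast
  have "x (Suc t) \<in> X" using step[OF t] closest_point_in_set[OF closed] IH(1) by auto
  moreover have "\<exists>p\<in>X. G p \<le> 0 \<and> norm (x (Suc t) - p) \<le> m"
  proof (cases "G (x t) \<le> tol")
    case True
    show ?thesis unfolding step[OF t]
      by (rule objective_step_near_feasible[OF sl IH(1) \<zeta>[OF t] m(1) \<nu>M])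
        (use True objective_step[OF t] tol in auto)
  next
    case False
    show ?thesis unfolding step[OF t]
      by (rule constraint_step_near_feasible[OF sl IH(1) _ m(2) IH(2)])
        (use False constraint_step[OF t] tol_pos in auto)
  qed
  ultimately show ?case by blast
qed

lemma iterate_mem: "t \<le> T \<Longrightarrow> x t \<in> X"
  using iterate_near_feasible by blast

lemma iterate_constraint_le: "t \<le> T \<Longrightarrow> G (x t) \<le> M * m"
  using iterate_near_feasible near_feasible_imp by blast

lemma iterate_slater: "t \<le> T \<Longrightarrow> slater (x t)"
  using iterate_mem iterate_constraint_le slater by blast

text \<open>In a constraint step the numerator exceeds \<open>tol\<close> and the denominator is at
  most \<open>M\<^sup>2\<close>. This makes the sum of the stepsizes grow at least linearly in
  \<open>T\<close>.\<close>

lemma stepsize_ge: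
  assumes t: "t < T"
  shows "tol / M\<^sup>2 \<le> \<eta> t"
proof (cases "G (x t) \<le> tol")
  case True
  thus ?thesis using objective_step[OF t] by simp
next
  case False
  hence s: "weak_subgradient G (x t) (\<zeta> t)" "\<eta> t = G (x t) / (norm (\<zeta> t))\<^sup>2"
    using constraint_step[OF t] by auto
  have "\<zeta> t \<noteq> 0" using constraint_subgradient_nonzero[OF iterate_slater s(1)] t False tol_pos by simp
  thus ?thesis unfolding s(2) using \<zeta>[OF t] False tol_pos
    by (intro frac_le power_mono) auto
qed

lemma stepsize_pos: "t < T \<Longrightarrow> 0 < \<eta> t"
  using stepsize_ge[of t] tol_pos M by (meson divide_pos_pos less_le_trans zero_less_power)

text \<open>Both kinds of step change the squared distance to \<open>p\<close> by at most
  \<open>\<eta> t * (P - \<kappa> * d)\<close>; \<open>prox_potential_change\<close> turns this into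
  a change of the proximal value.\<close>

lemma step_potential_decrease:
  assumes t: "t < T" and p: "is_prox (x t) p" and p': "is_prox (x (Suc t)) p'"
  shows "prox_objective (x (Suc t)) p' \<le> prox_objective (x t) p
    + r / 2 * (\<eta> t * ((1 + \<Lambda>) * (1 + 2 * \<Lambda>) * tol - \<kappa> * (norm (p - x t))\<^sup>2))"
proof -
  define d where "d = (norm (p - x t))\<^sup>2"
  define P where "P = tol * (1 + 2 * \<Lambda>)"
  define c where "c = (norm (p - x (Suc t)))\<^sup>2 - (norm (p - x t))\<^sup>2"
  have P: "0 \<le> P" using tol_pos constants_pos by (simp add: P_def)
  have d: "0 \<le> \<kappa> * d" using constants_pos by (simp add: d_def)
  have sl: "slater (x t)" "slater (x (Suc t))" and X: "x t \<in> X" "x (Suc t) \<in> X"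
    using iterate_slater iterate_mem t by auto
  have c: "c \<le> \<eta> t * (P - \<kappa> * d)"
  proof (cases "G (x t) \<le> tol")
    case True
    show ?thesis unfolding step[OF t] c_def P_def d_def
      by (rule objective_step_distance[OF sl(1) X(1) p])
        (use True objective_step[OF t] \<zeta>[OF t] tol_pos in auto)
  next
    case False
    have "c \<le> - \<eta> t * (\<kappa> * d)" unfolding step[OF t] c_def d_def
      by (rule constraint_step_distance[OF sl(1) p])
        (use False constraint_step[OF t] tol_pos in auto)
    moreover have "0 \<le> \<eta> t * P" using stepsize_pos[OF t] P by simp
    ultimately show ?thesis by (simp add: algebra_simps)
  qed
  obtain \<mu> where \<mu>: "0 \<le> \<mu>" "\<mu> \<le> \<Lambda>"
    and dec: "prox_objective (x (Suc t)) p' \<le> prox_objective (x t) p + (1 + \<mu>) * (r / 2 * c)"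
    using prox_potential_change[OF sl(2) X(2) p p'] unfolding c_def by blast
  have "(1 + \<mu>) * c \<le> (1 + \<mu>) * (\<eta> t * (P - \<kappa> * d))" using c \<mu> by (intro mult_left_mono) auto
  also have "\<dots> = \<eta> t * ((1 + \<mu>) * P - (1 + \<mu>) * (\<kappa> * d))" by (simp add: algebra_simps)
  \<comment> \<open>The unknown \<open>\<mu>\<close> is replaced by its largest value
    \<open>\<Lambda>\<close> in the error term and by its smallest value 0 in the decrease.\<close>
  also have "\<dots> \<le> \<eta> t * ((1 + \<Lambda>) * P - 1 * (\<kappa> * d))"
    using \<mu> P d stepsize_pos[OF t] by (intro mult_left_mono diff_mono mult_right_mono) auto
  finally have "r / 2 * ((1 + \<mu>) * c) \<le> r / 2 * (\<eta> t * ((1 + \<Lambda>) * P - 1 * (\<kappa> * d)))"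
    using constants_pos by (intro mult_left_mono) auto
  thus ?thesis using dec by (simp add: P_def d_def algebra_simps)
qed

text \<open>The telescoped proximal value starts at most at \<open>F (x 0)\<close>, because
  \<open>x 0\<close> is feasible in its own proximal problem, and ends no lower than
  \<open>low\<close>.\<close>

lemma weighted_sq_distance_sum_le:
  assumes p: "\<And>t. t < T \<Longrightarrow> is_prox (x t) (p t)"
  shows "\<kappa> * (\<Sum>t<T. \<eta> t * (norm (p t - x t))\<^sup>2)
    \<le> (1 + \<Lambda>) * (1 + 2 * \<Lambda>) * tol * (\<Sum>t<T. \<eta> t) + 2 / r * (F (x 0) - low)"
proof -
  \<comment> \<open>The family \<open>q\<close> extends to the index \<open>T\<close>, where
    \<open>p\<close> is not controlled; the optimal values agree for \<open>t < T\<close>.\<close>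
  obtain q where q: "\<And>t. t \<le> T \<Longrightarrow> is_prox (x t) (q t)"
    using prox_exists[OF iterate_slater] by metis
  define \<Phi> where "\<Phi> t = prox_objective (x t) (q t)" for t
  have pq: "prox_objective (x t) (p t) = \<Phi> t" if "t < T" for t
    using p[OF that] q[of t] that unfolding is_prox_def \<Phi>_def by (auto intro!: antisym)
  have "\<Phi> n \<le> \<Phi> 0 + (\<Sum>t<n. r / 2 * (\<eta> t * ((1 + \<Lambda>) * (1 + 2 * \<Lambda>) * tol - \<kappa> * (norm (p t - x t))\<^sup>2)))"
    if "n \<le> T" for n
    using that
  proof (induction n)
    case (Suc n)
    thus ?case using step_potential_decrease[of n "p n" "q (Suc n)"] p[of n] q[of "Suc n"] pq[of n]
      by (simp add: \<Phi>_def)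
  qed simp
  from this[of T] have "\<Phi> T \<le> \<Phi> 0 + r / 2 * (\<Sum>t<T. \<eta> t * ((1 + \<Lambda>) * (1 + 2 * \<Lambda>) * tol - \<kappa> * (norm (p t - x t))\<^sup>2))"
    by (simp add: sum_distrib_left)
  moreover have "low \<le> \<Phi> T"
    using q[of T] low[of "q T"] constants_pos unfolding \<Phi>_def is_prox_def prox_objective_def by (auto intro: add_increasing2)
  moreover have "\<Phi> 0 \<le> F (x 0)"
    using q[of 0] x0 unfolding \<Phi>_def is_prox_def prox_objective_def prox_constraint_def by force
  ultimately have "- (r / 2) * (\<Sum>t<T. \<eta> t * ((1 + \<Lambda>) * (1 + 2 * \<Lambda>) * tol - \<kappa> * (norm (p t - x t))\<^sup>2)) \<le> F (x 0) - low"
    by linarith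
  hence "- (\<Sum>t<T. \<eta> t * ((1 + \<Lambda>) * (1 + 2 * \<Lambda>) * tol - \<kappa> * (norm (p t - x t))\<^sup>2)) \<le> 2 / r * (F (x 0) - low)"
    using constants_pos by (simp add: field_simps)
  thus ?thesis
    by (simp add: right_diff_distrib sum_subtractf sum_distrib_left sum_distrib_right mult.commute mult.left_commute)
qed

end

section \<open>The random output\<close>

text \<open>Positive stepsizes make the weights nonnegative with sum one, so
  \<open>embed_pmf\<close> has the intended mass function.\<close>

lemma expectation_output_II:
  fixes h :: "nat \<Rightarrow> real"
  assumes A: "finite A" "A \<noteq> {}" and pos: "\<And>t. t \<in> A \<Longrightarrow> 0 < \<eta> t"
  shows "measure_pmf.expectation (output_II A \<eta>) h = (\<Sum>t\<in>A. \<eta> t * h t) / (\<Sum>t\<in>A. \<eta> t)"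
proof -
  define W where "W = (\<Sum>t\<in>A. \<eta> t)"
  define w where "w t = (if t \<in> A then \<eta> t / W else 0)" for t
  have W: "0 < W" unfolding W_def using assms by (intro sum_pos) auto
  have w0: "0 \<le> w t" for t using pos[of t] W by (auto simp: w_def)
  have "(\<integral>\<^sup>+ t. ennreal (w t) \<partial>count_space UNIV) = (\<Sum>t\<in>A. ennreal (w t))"
    by (rule nn_integral_count_space'[OF A(1)]) (auto simp: w_def)
  also have "\<dots> = ennreal (\<Sum>t\<in>A. w t)" using w0 by (intro sum_ennreal) auto
  also have "(\<Sum>t\<in>A. w t) = (\<Sum>t\<in>A. \<eta> t / W)" by (intro sum.cong) (auto simp: w_def)
  also have "\<dots> = 1" using W by (simp add: sum_divide_distrib[symmetric] W_def[symmetric])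
  finally have one: "(\<integral>\<^sup>+ t. ennreal (w t) \<partial>count_space UNIV) = 1" by simp
  have out: "output_II A \<eta> = embed_pmf w"
    unfolding output_II_def w_def W_def by simp
  have pmf: "pmf (output_II A \<eta>) t = w t" for t
    unfolding out by (rule pmf_embed_pmf[OF w0 one])
  have "measure_pmf.expectation (output_II A \<eta>) h = (\<Sum>t\<in>A. h t * pmf (output_II A \<eta>) t)"
    by (rule integral_measure_pmf_real[OF A(1)]) (auto simp: set_pmf_iff pmf w_def split: if_splits)
  also have "\<dots> = (\<Sum>t\<in>A. \<eta> t * h t / W)" by (intro sum.cong) (auto simp: pmf w_def)
  finally show ?thesis by (simp add: W_def sum_divide_distrib)
qed

text \<open>Jensen's inequality for the square, obtained as the weighted sum of
  \<open>2 * c * d t \<le> (d t)\<^sup>2 + c\<^sup>2\<close>.\<close>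

lemma weighted_sum_le_of_squares:
  fixes w d :: "'b \<Rightarrow> real"
  assumes "\<And>t. t \<in> A \<Longrightarrow> 0 \<le> w t" "0 < c"
    and sq: "(\<Sum>t\<in>A. w t * (d t)\<^sup>2) \<le> c\<^sup>2 * (\<Sum>t\<in>A. w t)"
  shows "(\<Sum>t\<in>A. w t * d t) \<le> c * (\<Sum>t\<in>A. w t)"
proof -
  have "2 * c * (\<Sum>t\<in>A. w t * d t) = (\<Sum>t\<in>A. w t * (2 * c * d t))"
    by (simp add: sum_distrib_left algebra_simps)
  also have "\<dots> \<le> (\<Sum>t\<in>A. w t * ((d t)\<^sup>2 + c\<^sup>2))"
  proof (intro sum_mono mult_left_mono assms(1))
    show "2 * c * d t \<le> (d t)\<^sup>2 + c\<^sup>2" for t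
      using sum_squares_bound[of "d t" c] by (simp add: mult_ac)
  qed
  also have "\<dots> = (\<Sum>t\<in>A. w t * (d t)\<^sup>2) + c\<^sup>2 * (\<Sum>t\<in>A. w t)"
    by (simp add: distrib_left sum.distrib sum_distrib_right[symmetric])
  also have "\<dots> \<le> 2 * c * (c * (\<Sum>t\<in>A. w t))"
    using sq by (simp add: power2_eq_square)
  finally show ?thesis using assms(2) by simp
qed

section \<open>From the extended-real hypotheses to the real-valued setting\<close>

lemma subdifferential_weakly_convex:
  assumes "weakly_convex_on \<rho> X h" "y \<in> X" "w \<in> X" "\<zeta> \<in> subdifferential h y"
    and fin: "\<And>y. y \<in> X \<Longrightarrow> h y = ereal (H y)"
  shows "H y + \<zeta> \<bullet> (w - y) - \<rho> / 2 * (norm (w - y))\<^sup>2 \<le> H w"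
proof -
  have "h w \<ge> h y + ereal (\<zeta> \<bullet> (w - y) - \<rho> / 2 * (norm (w - y))\<^sup>2)"
    using assms(1-4) unfolding weakly_convex_on_def by blast
  thus ?thesis using fin assms(2,3) by simp
qed

text \<open>\<open>arg_min_on\<close> is a choice operator; \<open>prox_exists\<close> ensures that
  its choice is a minimizer.\<close>

lemma (in prox_problem) is_prox_proximal_point:
  assumes f: "\<And>y. y \<in> X \<Longrightarrow> f y = ereal (F y)" and g: "\<And>y. y \<in> X \<Longrightarrow> g y = ereal (G y)"
    and "slater z"
  shows "is_prox z (proximal_point X f g r z)"
proof -
  define K where "K = {y \<in> X. g y + ereal (r / 2 * (norm (y - z))\<^sup>2) \<le> 0}"
  define \<phi> where "\<phi> = (\<lambda>y. f y + ereal (r / 2 * (norm (y - z))\<^sup>2))"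
  have K: "y \<in> K \<longleftrightarrow> y \<in> X \<and> prox_constraint z y \<le> 0" for y
    by (auto simp: K_def g prox_constraint_def)
  have \<phi>: "\<phi> y = ereal (prox_objective z y)" if "y \<in> X" for y
    using f[OF that] by (simp add: \<phi>_def prox_objective_def)
  have min_iff: "is_arg_min \<phi> (\<lambda>y. y \<in> K) p \<longleftrightarrow> is_prox z p" for p
    unfolding is_arg_min_def is_prox_def K by (auto simp: \<phi> not_less)
  obtain p where "is_prox z p" using prox_exists assms(3) by blast
  hence "is_arg_min \<phi> (\<lambda>y. y \<in> K) (arg_min_on \<phi> K)"
    unfolding arg_min_on_def arg_min_def min_iff by (rule someI)
  thus ?thesis unfolding min_iff by (simp add: proximal_point_def \<phi>_def K_def)
qed

text \<open>From \<open>w\<close> to the Slater point \<open>G\<close> drops by at least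
  \<open>\<theta> + \<kappa> / 2 * D\<^sup>2 \<ge> \<nu> * D\<close>, but by at most
  \<open>M * D\<close>.\<close>

lemma (in prox_problem) sqrt_le_lipschitz_constant:
  assumes "w \<in> X" "0 \<le> G w" "slater w"
  shows "\<nu> \<le> M"
proof -
  obtain y where y: "y \<in> X" "prox_constraint w y \<le> - \<theta>" using assms(3) by (auto simp: slater_def)
  define D where "D = norm (w - y)"
  have "\<kappa> / 2 * D\<^sup>2 \<le> r / 2 * D\<^sup>2" using \<rho> by (intro mult_right_mono) (auto simp: \<kappa>_def)
  hence *: "\<theta> + \<kappa> / 2 * D\<^sup>2 \<le> M * D"
    using y(2) G_lip[OF y(1) assms(1)] assms(2)
    by (simp add: prox_constraint_def D_def norm_minus_commute)
  have "0 \<le> \<kappa> / 2 * D\<^sup>2" using constants_pos by simp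
  hence "D \<noteq> 0" using * \<theta> by auto
  hence D: "0 < D" by (simp add: D_def)
  have "\<nu> * D \<le> M * D"
    using * amgm_sqrt[of \<theta> \<kappa> D] \<theta> constants_pos by (simp add: \<nu>_def \<kappa>_def)
  thus ?thesis using D by simp
qed

theorem theorem5p6:
  fixes X :: "'a::euclidean_space set"
    and f g :: "'a \<Rightarrow> ereal"
    and M \<rho> \<rho>_bar \<rho>_hat \<theta> eps_bar eps \<nu> \<Lambda> C m :: real
    and tol \<eta> :: "nat \<Rightarrow> real"
    and x \<zeta>f \<zeta>g :: "nat \<Rightarrow> 'a"
    and T :: nat
    and I J :: "nat set"
  assumes X: "closed X" "convex X"
    and no_minus_infty: "\<forall>y. f y \<noteq> -\<infinity>" "\<forall>y. g y \<noteq> -\<infinity>"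
    and finite_on_X: "\<forall>y\<in>X. f y \<noteq> \<infinity>" "\<forall>y\<in>X. g y \<noteq> \<infinity>"
    and cont: "continuous_on X f" "continuous_on X g"
    and subdiff_nonempty:
      "\<forall>y\<in>X. subdifferential f y \<noteq> {}" "\<forall>y\<in>X. subdifferential g y \<noteq> {}"
    and M_pos: "M > 0"
    and subgrad_bounded:
      "\<forall>y\<in>X. \<forall>\<zeta>\<in>subdifferential f y. norm \<zeta> \<le> M"
      "\<forall>y\<in>X. \<forall>\<zeta>\<in>subdifferential g y. norm \<zeta> \<le> M"
    and A: "weakly_convex_on \<rho> X f" "weakly_convex_on \<rho> X g"
    and B: "eps_bar > 0" "\<theta> > 0" "\<rho>_bar > \<rho>"
      "\<forall>z\<in>X. g z \<le> ereal (eps_bar\<^sup>2) \<longrightarrow>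
         (\<exists>y\<in>rel_interior X. g y + ereal (\<rho>_bar / 2 * (norm (y - z))\<^sup>2) \<le> ereal (- \<theta>))"
    and C: "(INF y\<in>X. f y) > -\<infinity>"
    and \<rho>_hat: "\<rho>_bar \<ge> \<rho>_hat" "\<rho>_hat > \<rho>"
    and eps: "0 < eps" "eps \<le> eps_bar"
    and \<nu>: "\<nu> = sqrt (2 * \<theta> * (\<rho>_hat - \<rho>))"
    and \<Lambda>: "\<Lambda> = 2 * M / sqrt (2 * \<theta> * (\<rho>_hat - \<rho>))"
    and C_const: "C = 2 * sqrt ((1 + \<Lambda>) / (\<rho>_hat - \<rho>))"
    and never_active: "(\<forall>y\<in>X. g y < 0) \<longrightarrow> \<nu> \<le> M"
    and m: "m = capped_min (eps\<^sup>2 / M) \<nu> \<rho>"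
    and run: "switching_subgradient_run X f g T tol \<eta> x \<zeta>f \<zeta>g"
    and x0: "g (x 0) \<le> 0"
    and I: "I = index_set_I g T 0 tol x"
    and J: "J = index_set_J g T 0 tol x"
    and tol: "\<forall>t. tol t = \<nu> / 4 * m"
    and \<eta>: "\<forall>t\<in>I. \<eta> t = \<nu> / (4 * M\<^sup>2) * m"
      "\<forall>t\<in>J. \<eta> t = real_of_ereal (g (x t)) / (norm (\<zeta>g t))\<^sup>2"
    and T: "real T \<ge>
      8 * M\<^sup>2 * (real_of_ereal (f (x 0)) - real_of_ereal (INF y\<in>X. f y) + 3 * M\<^sup>2 / (2 * \<rho>_hat)) /
      (\<rho>_hat * (1 + \<Lambda>) * \<nu> * eps\<^sup>2 * m)"
  shows "measure_pmf.expectation (output_II (I \<union> J) \<eta>)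
           (\<lambda>t. norm (proximal_point X f g \<rho>_hat (x t) - x t)) \<le> C * eps
       \<and> measure_pmf.expectation (output_II (I \<union> J) \<eta>)
           (\<lambda>t. real_of_ereal (g (x t))) \<le> eps\<^sup>2"
proof -
  define F G low where "F y = real_of_ereal (f y)" and "G y = real_of_ereal (g y)"
    and "low = real_of_ereal (INF y\<in>X. f y)" for y
  have fF: "f y = ereal (F y)" and gG: "g y = ereal (G y)" if "y \<in> X" for y
    using that no_minus_infty finite_on_X unfolding F_def G_def by (auto simp: ereal_real)
  have r0: "0 \<le> \<rho>" using A by (simp add: weakly_convex_on_def)
  have r: "0 < \<rho>_hat" using r0 \<rho>_hat by simp
  have x0X: "x 0 \<in> X" and T0: "0 < T" using run by (auto simp: switching_subgradient_run_def)
  have low: "low \<le> F y" if y: "y \<in> X" for y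
  proof -
    have "(INF y\<in>X. f y) \<le> f y" by (rule INF_lower[OF y])
    \<comment> \<open>The infimum is a real number: \<open>C\<close> rules out minus infinity and
      the finite value \<open>f y\<close> rules out plus infinity, so \<open>real_of_ereal\<close>
      does not fall back to its default 0.\<close>
    thus ?thesis using C fF[OF y] unfolding low_def
      by (cases "INF y\<in>X. f y") auto
  qed
  note subF = subdifferential_weakly_convex[OF A(1) _ _ _ fF]
    and subG = subdifferential_weakly_convex[OF A(2) _ _ _ gG]
  have F_sub: "\<exists>\<zeta>. norm \<zeta> \<le> M \<and> (\<forall>w\<in>X. F w \<ge> F y + \<zeta> \<bullet> (w - y) - \<rho> / 2 * (norm (w - y))\<^sup>2)"
    and G_sub: "\<exists>\<zeta>. norm \<zeta> \<le> M \<and> (\<forall>w\<in>X. G w \<ge> G y + \<zeta> \<bullet> (w - y) - \<rho> / 2 * (norm (w - y))\<^sup>2)"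
    if y: "y \<in> X" for y
    using y subdiff_nonempty subgrad_bounded subF[OF y] subG[OF y] by (meson ex_in_conv)+
  interpret P: prox_problem X F G M \<rho> \<rho>_hat \<theta> low
  proof
    show "segment_weakly_convex \<rho> X F" "segment_weakly_convex \<rho> X G"
      by (rule segment_weakly_convex_subgradient[OF X(2)], use F_sub G_sub in blast)+
    show "F b - F a \<le> M * norm (b - a)" "G b - G a \<le> M * norm (b - a)" if "a \<in> X" "b \<in> X" for a b
      using lipschitz_of_subgradients[OF X(2) F_sub that] lipschitz_of_subgradients[OF X(2) G_sub that]
      by auto
  qed (use X M_pos r0 \<rho>_hat B low in auto)
  have P\<nu>: "P.\<nu> = \<nu>" by (simp add: P.\<nu>_def \<nu>)
  have P\<Lambda>: "P.\<Lambda> = \<Lambda>" by (simp add: P.\<Lambda>_def P.\<nu>_def \<Lambda>)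
  have pos: "0 < \<nu>" "0 < \<Lambda>" "0 < P.\<kappa>" using P.constants_pos by (simp_all add: P\<nu> P\<Lambda>)
  have slater: "P.slater z" if z: "z \<in> X" "G z \<le> eps_bar\<^sup>2" for z
  proof -
    obtain y where y: "y \<in> rel_interior X" "g y + ereal (\<rho>_bar / 2 * (norm (y - z))\<^sup>2) \<le> ereal (- \<theta>)"
      using B(4) z gG[OF z(1)] by auto
    have yX: "y \<in> X" using y(1) rel_interior_subset by blast
    have "\<rho>_hat / 2 * (norm (y - z))\<^sup>2 \<le> \<rho>_bar / 2 * (norm (y - z))\<^sup>2"
      using \<rho>_hat by (intro mult_right_mono) auto
    thus ?thesis using y(2) yX gG[OF yX] unfolding P.slater_def P.prox_constraint_def
      by (intro bexI[of _ y]) auto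
  qed
  have Gx0: "G (x 0) \<le> 0" using x0 gG[OF x0X] by simp
  have \<nu>M: "\<nu> \<le> M"
  proof (cases "\<forall>y\<in>X. g y < 0")
    case True
    thus ?thesis using never_active by blast
  next
    case False
    then obtain y where y: "y \<in> X" "0 \<le> G y" using gG by (auto simp: not_less)
    \<comment> \<open>Slater's condition is known only where \<open>G\<close> is at most
      \<open>eps_bar\<^sup>2\<close>, so \<open>y\<close> is traded for an exact zero of
      \<open>G\<close>, which exists because \<open>G (x 0) \<le> 0 \<le> G y\<close>.\<close>
    have "connected (G ` X)"
      using P.G_continuous X(2) by (intro connected_continuous_image convex_connected)
    hence "0 \<in> G ` X"
      using connectedD_interval[of "G ` X" "G (x 0)" "G y" 0] x0X y Gx0 by auto
    then obtain w where "w \<in> X" "G w = 0" by auto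
    thus ?thesis using P.sqrt_le_lipschitz_constant[of w] slater[of w] by (simp add: P\<nu>)
  qed
  have m_pos: "0 < m" and m_le: "m \<le> eps\<^sup>2 / M" and \<rho>m: "\<rho> * m \<le> \<nu>"
  proof -
    show "0 < m" "m \<le> eps\<^sup>2 / M"
      using eps M_pos pos r0 unfolding m capped_min_def by auto
    show "\<rho> * m \<le> \<nu>"
    proof (cases "\<rho> = 0")
      case False
      hence "\<rho> * m \<le> \<rho> * (\<nu> / (4 * \<rho>))"
        using r0 unfolding m capped_min_def by (intro mult_left_mono) auto
      thus ?thesis using False pos by simp
    qed (use pos in simp)
  qed
  have Mm: "M * m \<le> eps\<^sup>2" using m_le M_pos by (simp add: field_simps)
  have eps_le: "eps\<^sup>2 \<le> eps_bar\<^sup>2" using eps by (intro power_mono) auto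
  define tl where "tl = \<nu> / 4 * m"
  have tl: "tol t = tl" for t using tol by (simp add: tl_def)
  have tl_pos: "0 < tl" using pos m_pos by (simp add: tl_def)
  define \<zeta> where "\<zeta> t = (if g (x t) \<le> ereal tl then \<zeta>f t else \<zeta>g t)" for t
  have xX: "x t \<in> X" if "t \<le> T" for t
    using that
  proof (induction t)
    case (Suc t)
    have "closest_point X v \<in> X" for v using closest_point_in_set[OF X(1)] x0X by blast
    thus ?case using run Suc by (auto simp: switching_subgradient_run_def Suc_le_eq split: if_splits)
  qed (rule x0X)
  have run': "if G (x t) \<le> tl then \<zeta> t \<in> subdifferential f (x t) else \<zeta> t \<in> subdifferential g (x t)"
    and step: "x (Suc t) = closest_point X (x t - \<eta> t *\<^sub>R \<zeta> t)" if "t < T" for t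
    using run that gG[OF xX, of t]
    by (auto simp: switching_subgradient_run_def tl \<zeta>_def split: if_splits)
  have I_iff: "t \<in> I \<longleftrightarrow> t < T \<and> G (x t) \<le> tl" and J_iff: "t \<in> J \<longleftrightarrow> t < T \<and> tl < G (x t)" for t
    using gG[OF xX, of t] by (auto simp: I J index_set_I_def index_set_J_def tl not_le)
  have IJ: "I \<union> J = {..<T}" by (auto simp: I_iff J_iff)
  interpret R: switching_run X F G M \<rho> \<rho>_hat \<theta> low m tl x \<zeta> \<eta> T
  proof
    show "0 < m" "\<rho> * m \<le> P.\<nu>" "tl = P.\<nu> / 4 * m" "P.\<nu> \<le> M" "x 0 \<in> X" "G (x 0) \<le> 0"
      by (simp_all add: P\<nu> m_pos \<rho>m tl_def \<nu>M x0X Gx0)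
    show "P.slater z" if "z \<in> X" "G z \<le> M * m" for z
      using slater that Mm eps_le by fastforce
    fix t assume t: "t < T"
    have xt: "x t \<in> X" using xX t by simp
    show "norm (\<zeta> t) \<le> M" using run'[OF t] subgrad_bounded xt by (auto split: if_splits)
    show "x (Suc t) = closest_point X (x t - \<eta> t *\<^sub>R \<zeta> t)" by (rule step[OF t])
    show "P.weak_subgradient F (x t) (\<zeta> t) \<and> \<eta> t = tl / M\<^sup>2" if "G (x t) \<le> tl"
      using run'[OF t] subF[OF xt] that \<eta>(1) t
      by (auto simp: P.weak_subgradient_def I_iff tl_def)
    show "P.weak_subgradient G (x t) (\<zeta> t) \<and> \<eta> t = G (x t) / (norm (\<zeta> t))\<^sup>2" if "tl < G (x t)"
      using run'[OF t] subG[OF xt] that \<eta>(2) t gG[OF xt]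
      by (auto simp: P.weak_subgradient_def J_iff \<zeta>_def)
  qed
  define W where "W = (\<Sum>t<T. \<eta> t)"
  have \<eta>_pos: "0 < \<eta> t" if "t \<in> {..<T}" for t using R.stepsize_pos that by simp
  have W_pos: "0 < W" unfolding W_def using \<eta>_pos T0 by (intro sum_pos) auto
  have ne: "{..<T} \<noteq> {}" using T0 by auto
  have expectation: "measure_pmf.expectation (output_II (I \<union> J) \<eta>) h = (\<Sum>t<T. \<eta> t * h t) / W"
    for h
    unfolding IJ W_def by (rule expectation_output_II[OF finite_lessThan ne \<eta>_pos])
  define p where "p t = proximal_point X f g \<rho>_hat (x t)" for t
  have p: "P.is_prox (x t) (p t)" if "t < T" for t
    unfolding p_def using that R.iterate_slater[of t] by (intro P.is_prox_proximal_point fF gG) auto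
  have W_ge: "2 / \<rho>_hat * (F (x 0) - low) \<le> (1 + \<Lambda>) * eps\<^sup>2 * W"
  proof -
    define Q where "Q = \<rho>_hat * (1 + \<Lambda>) * eps\<^sup>2"
    have Q: "0 < Q" using r pos eps by (simp add: Q_def)
    define N R where "N = F (x 0) - low" and "R = 3 * M\<^sup>2 / (2 * \<rho>_hat)"
    \<comment> \<open>Every stepsize is at least \<open>tl / M\<^sup>2\<close>; multiplied by this,
      the lower bound on \<open>T\<close> simplifies to \<open>2 * (N + R) / Q\<close>.\<close>
    have "real T * (tl / M\<^sup>2) \<le> W"
      using sum_mono[of "{..<T}" "\<lambda>_. tl / M\<^sup>2" \<eta>] R.stepsize_ge by (simp add: W_def)
    moreover have "8 * M\<^sup>2 * (N + R) / (Q * (\<nu> * m)) * (tl / M\<^sup>2)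
        \<le> real T * (tl / M\<^sup>2)"
      using T tl_pos by (intro mult_right_mono) (auto simp: N_def R_def Q_def F_def low_def mult_ac)
    moreover have "8 * M\<^sup>2 * (N + R) / (Q * (\<nu> * m)) * (tl / M\<^sup>2)
        = 2 * (N + R) / Q"
      using M_pos pos m_pos Q by (simp add: tl_def field_simps)
    ultimately have "2 * (N + R) / Q \<le> W" by linarith
    hence *: "2 * (N + R) \<le> W * Q" using Q by (simp add: pos_divide_le_eq)
    have "0 \<le> R" using r by (simp add: R_def)
    hence "2 * N \<le> 2 * (N + R)" by simp
    also note *
    finally have "2 * N \<le> W * Q" .
    thus ?thesis using r by (simp add: N_def Q_def field_simps)
  qed
  \<comment> \<open>As \<open>\<Lambda> * \<nu> = 2 * M\<close>, the left side equals
    \<open>(\<nu> + 4 * M) * m / 4\<close>, at most \<open>5 / 4 * (M * m)\<close> since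
    \<open>\<nu> \<le> M\<close>.\<close>
  have tol_le: "(1 + 2 * \<Lambda>) * tl \<le> 2 * eps\<^sup>2"
  proof -
    have "\<Lambda> = 2 * M / \<nu>" unfolding \<Lambda> \<nu> ..
    hence \<Lambda>\<nu>: "\<Lambda> * \<nu> = 2 * M" using pos(1) by simp
    have "(1 + 2 * \<Lambda>) * tl = (\<nu> + 4 * M) * m / 4"
      using \<Lambda>\<nu> by (simp add: tl_def algebra_simps)
    also have "\<dots> \<le> (5 * M) * m / 4"
      using \<nu>M m_pos by (intro divide_right_mono mult_right_mono) auto
    also have "\<dots> = 5 / 4 * (M * m)" by simp
    also have "\<dots> \<le> 2 * eps\<^sup>2" using Mm zero_le_power2[of eps] by linarith
    finally show ?thesis .
  qed
  have sq: "(\<Sum>t<T. \<eta> t * (norm (p t - x t))\<^sup>2) \<le> (C * eps)\<^sup>2 * W"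
  proof -
    have "P.\<kappa> * (\<Sum>t<T. \<eta> t * (norm (p t - x t))\<^sup>2)
        \<le> (1 + \<Lambda>) * (1 + 2 * \<Lambda>) * tl * W + 2 / \<rho>_hat * (F (x 0) - low)"
      using R.weighted_sq_distance_sum_le[OF p] by (simp add: P\<Lambda> W_def)
    \<comment> \<open>The tolerance contributes the factor 2 and the initial gap the factor 1; their
      sum is rounded up to 4 to match
      \<open>P.\<kappa> * C\<^sup>2 = 4 * (1 + \<Lambda>)\<close>.\<close>
    also have "\<dots> \<le> (1 + \<Lambda>) * (2 * eps\<^sup>2) * W + (1 + \<Lambda>) * eps\<^sup>2 * W"
      using tol_le W_ge pos W_pos
      by (intro add_mono mult_right_mono) (auto simp: mult.assoc)
    also have "\<dots> \<le> 4 * (1 + \<Lambda>) * eps\<^sup>2 * W" using pos W_pos by (simp add: algebra_simps)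
    also have "4 * (1 + \<Lambda>) * eps\<^sup>2 * W = P.\<kappa> * ((C * eps)\<^sup>2 * W)"
      using pos unfolding C_const by (simp add: P.\<kappa>_def power_mult_distrib)
    finally show ?thesis using pos by simp
  qed
  have "0 < C * eps" using pos eps unfolding C_const by (simp add: P.\<kappa>_def)
  hence "(\<Sum>t<T. \<eta> t * norm (p t - x t)) \<le> C * eps * W"
    using weighted_sum_le_of_squares[of "{..<T}" \<eta> "C * eps" "\<lambda>t. norm (p t - x t)"] sq \<eta>_pos
    by (simp add: W_def less_imp_le)
  moreover have "(\<Sum>t<T. \<eta> t * G (x t)) \<le> eps\<^sup>2 * W"
  proof -
    have "G (x t) \<le> eps\<^sup>2" if "t < T" for t
      using R.iterate_constraint_le[of t] Mm that by simp
    hence "(\<Sum>t<T. \<eta> t * G (x t)) \<le> (\<Sum>t<T. \<eta> t * eps\<^sup>2)"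
      using \<eta>_pos by (intro sum_mono mult_left_mono) (auto intro: less_imp_le)
    thus ?thesis by (simp add: W_def sum_distrib_right[symmetric] mult.commute)
  qed
  ultimately show ?thesis
    using W_pos unfolding expectation by (simp add: p_def G_def pos_divide_le_eq)
qed

end
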